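(* A purely inseparable extension $K/k$ is $q$-finite if and only if it satisfies the following two conditions: (i) Every decreasing sequence of intermediate fields of $K/k$ is stationary. (ii) For every intermediate field $L\ne k$ of $K/k$, one has $mod(L/k)\ne L$.
   Context: All fields are commutative of characteristic $p>0$. A subset $B\subseteq K$ is an $r$-base of an extension $K/k$ if $K=k(K^p)(B)$ and, for every $x\in B$, $x\notin k(K^p)(B\setminus\{x\})$; every extension has an $r$-base and all $r$-bases of a given extension have the same cardinality. For a purely inseparable extension $K/k$ and $n\ge 1$, put $k_n=\{x\in K: x^{p^n}\in k\}$ and let $B_n$ be an $r$-base of $k_n/k$. The degree of irrationality is the cardinal $di(K/k)=\sup_{n\ge 1}|B_n|$, and $K/k$ is $q$-finite if $di(K/k)$ is finite. An extension $L/m$ is modular if for every $n\in\mathbb N$ the fields $L^{p^n}$ and $m$ are linearly disjoint over $L^{p^n}\cap m$. For a purely inseparable extension $L/k$, $mod(L/k)$ denotes the smallest intermediate field $m$ of $L/k$ such that $L/m$ is modular (it exists). *)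

theory Defs
  imports
    "HOL-Algebra.Generated_Fields"
    "HOL-Algebra.Embedded_Algebras"
    "HOL-Computational_Algebra.Primes"
begin

text \<open>
  All fields occurring below are subfields of one ambient field \<open>R\<close> (later the top field of
  the extension), which has prime characteristic \<open>p\<close>.
\<close>

definition intermediate_field :: "('a, 'b) ring_scheme \<Rightarrow> 'a set \<Rightarrow> 'a set \<Rightarrow> 'a set \<Rightarrow> bool"
  where "intermediate_field R L k m \<longleftrightarrow> subfield m R \<and> k \<subseteq> m \<and> m \<subseteq> L"

definition field_extension :: "('a, 'b) ring_scheme \<Rightarrow> 'a set \<Rightarrow> 'a set \<Rightarrow> bool"
  where "field_extension R L k \<longleftrightarrow> subfield L R \<and> subfield k R \<and> k \<subseteq> L"

definition purely_inseparable :: "('a, 'b) ring_scheme \<Rightarrow> nat \<Rightarrow> 'a set \<Rightarrow> 'a set \<Rightarrow> bool"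
  where "purely_inseparable R p L k \<longleftrightarrow>
    field_extension R L k \<and> (\<forall>x\<in>L. \<exists>n::nat. x [^]\<^bsub>R\<^esub> (p ^ n) \<in> k)"

definition adjoin :: "('a, 'b) ring_scheme \<Rightarrow> 'a set \<Rightarrow> 'a set \<Rightarrow> 'a set"
  where "adjoin R k S = generate_field R (k \<union> S)"

text \<open>The field \<open>L\<^bsup>p^n\<^esup>\<close> of \<open>p^n\<close>-th powers of elements of \<open>L\<close>.\<close>

definition frob_power :: "('a, 'b) ring_scheme \<Rightarrow> nat \<Rightarrow> nat \<Rightarrow> 'a set \<Rightarrow> 'a set"
  where "frob_power R p n L = (\<lambda>x. x [^]\<^bsub>R\<^esub> (p ^ n)) ` L"

definition r_base :: "('a, 'b) ring_scheme \<Rightarrow> nat \<Rightarrow> 'a set \<Rightarrow> 'a set \<Rightarrow> 'a set \<Rightarrow> bool"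
  where "r_base R p L k B \<longleftrightarrow> B \<subseteq> L \<and>
    L = adjoin R (adjoin R k (frob_power R p 1 L)) B \<and>
    (\<forall>x\<in>B. x \<notin> adjoin R (adjoin R k (frob_power R p 1 L)) (B - {x}))"

text \<open>The field \<open>k\<^sub>n\<close> of elements of \<open>L\<close> whose \<open>p^n\<close>-th power lies in \<open>k\<close>.\<close>

definition level_field :: "('a, 'b) ring_scheme \<Rightarrow> nat \<Rightarrow> 'a set \<Rightarrow> 'a set \<Rightarrow> nat \<Rightarrow> 'a set"
  where "level_field R p L k n = {x \<in> L. x [^]\<^bsub>R\<^esub> (p ^ n) \<in> k}"

text \<open>
  Cardinals are represented, as in the library, by cardinal orders (unique up to order
  isomorphism); \<open>card_sup A\<close> is the supremum of a set \<open>A\<close> of cardinals. It can be formed on the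
  same type, because the cardinality of that type bounds every element of \<open>A\<close>.
\<close>

context
  includes cardinal_syntax
begin

definition is_card_sup :: "'a rel set \<Rightarrow> 'a rel \<Rightarrow> bool"
  where "is_card_sup A r \<longleftrightarrow> Card_order r \<and> (\<forall>s\<in>A. s \<le>o r) \<and>
    (\<forall>t::'a rel. Card_order t \<and> (\<forall>s\<in>A. s \<le>o t) \<longrightarrow> r \<le>o t)"

definition card_sup :: "'a rel set \<Rightarrow> 'a rel"
  where "card_sup A = (SOME r. is_card_sup A r)"

lemma is_card_sup_card_sup:
  fixes A :: "'a rel set"
  assumes "\<And>s. s \<in> A \<Longrightarrow> Card_order s"
  shows "is_card_sup A (card_sup A)"
proof -
  let ?U = "{t :: 'a rel. Card_order t \<and> (\<forall>s\<in>A. s \<le>o t)}"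
  have "s \<le>o |UNIV :: 'a set|" if "s \<in> A" for s
    by (rule ordIso_ordLeq_trans[OF ordIso_symmetric[OF card_of_Field_ordIso[OF assms[OF that]]]])
      (rule card_of_mono1[OF subset_UNIV])
  then have "|UNIV :: 'a set| \<in> ?U"
    by (simp add: card_of_Card_order)
  then have "\<exists>r\<in>?U. \<forall>r'\<in>?U. r \<le>o r'"
    by (intro exists_minim_Card_order) (use \<open>|UNIV :: 'a set| \<in> ?U\<close> in fast, fast)
  then have "\<exists>r. is_card_sup A r"
    unfolding is_card_sup_def by fast
  then show ?thesis
    unfolding card_sup_def by (rule someI_ex)
qed

text \<open>
  All \<open>r\<close>-bases of \<open>k\<^sub>n/k\<close> have the same cardinality, so taking the supremum over all of
  them is the same as choosing one \<open>B\<^sub>n\<close> for each \<open>n\<close>.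
\<close>

definition degree_of_irrationality ::
    "('a, 'b) ring_scheme \<Rightarrow> nat \<Rightarrow> 'a set \<Rightarrow> 'a set \<Rightarrow> 'a rel"
  where "degree_of_irrationality R p L k =
    card_sup {|B| | n B. 1 \<le> n \<and> r_base R p (level_field R p L k n) k B}"

end

definition q_finite :: "('a, 'b) ring_scheme \<Rightarrow> nat \<Rightarrow> 'a set \<Rightarrow> 'a set \<Rightarrow> bool"
  where "q_finite R p L k \<longleftrightarrow> finite (Field (degree_of_irrationality R p L k))"

text \<open>
  Linear disjointness of \<open>A\<close> and \<open>B\<close> over a common subfield \<open>C\<close>. This is the usual condition,
  symmetric in \<open>A\<close> and \<open>B\<close>; finite lists suffice since independence is of finite character.
\<close>

definition linearly_disjoint :: "('a, 'b) ring_scheme \<Rightarrow> 'a set \<Rightarrow> 'a set \<Rightarrow> 'a set \<Rightarrow> bool"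
  where "linearly_disjoint R C A B \<longleftrightarrow>
    (\<forall>Us. set Us \<subseteq> A \<and> ring.independent R C Us \<longrightarrow> ring.independent R B Us)"

definition modular_extension :: "('a, 'b) ring_scheme \<Rightarrow> nat \<Rightarrow> 'a set \<Rightarrow> 'a set \<Rightarrow> bool"
  where "modular_extension R p L m \<longleftrightarrow>
    (\<forall>n. linearly_disjoint R (frob_power R p n L \<inter> m) (frob_power R p n L) m)"

definition mod_field :: "('a, 'b) ring_scheme \<Rightarrow> nat \<Rightarrow> 'a set \<Rightarrow> 'a set \<Rightarrow> 'a set"
  where "mod_field R p L k =
    (LEAST m. intermediate_field R L k m \<and> modular_extension R p L m)"

end

theory Submission
  imports "HOL-Algebra.Finite_Extensions" Defs
begin

text \<open>
  The proof replaces \<open>q\<close>-finiteness by a condition on finite sequences. A sequence is called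
  relatively independent over a base \<open>F\<close> here if, adjoined one entry at a time to \<open>F(E^p)\<close>, where
  \<open>E\<close> is the field that the sequence generates over \<open>F\<close>, it gives a strictly increasing tower.
  The rank of an extension is the supremum of the lengths of such sequences. As the condition
  mentions only the base and the sequence, the rank cannot grow when the base is enlarged or the
  extension is shrunk, and \<open>K/k\<close> is \<open>q\<close>-finite exactly if its rank is bounded
  (\<open>q_finite_iff_rank_le\<close>). The comparison with \<open>r\<close>-bases uses the inequality
  \<open>[E : k(E^p)] \<le> [M : k(M^p)]\<close> for \<open>E \<subseteq> M\<close> finite over \<open>k\<close>, which Frobenius provides
  (\<open>dim_mod_pth_powers_mono\<close>), and the existence of \<open>r\<close>-bases, which rests on the fact that a
  nontrivial extension by a \<open>p\<close>-th root has degree exactly \<open>p\<close> (\<open>Irr_pth_root\<close>, \<open>exchange\<close>).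

  Suppose that the rank is bounded. If a decreasing chain with intersection \<open>G\<close> did not stop,
  elements of exponent one over \<open>G\<close> that are lost along the chain, arranged backwards, would form
  arbitrarily long independent sequences (\<open>dcc_of_rank_le\<close>); this is (i). Modularity over two
  subfields passes to their intersection (\<open>modular_Int\<close>), so by (i) the field \<open>mod(L/k)\<close> exists, and
  for (ii) it suffices to find one \<open>m \<noteq> L\<close> over which \<open>L\<close> is modular
  (\<open>exists_proper_modular\<close>). If \<open>L \<noteq> k(L^p)\<close>, take \<open>m = k(L^p)\<close>. If \<open>L = k(L^p)\<close>, the levels of \<open>L\<close>
  contain a strictly increasing tower \<open>T\<close> starting at \<open>k\<close> with \<open>k(T (j + 1)^p) = T j\<close>
  (\<open>exists_tower\<close>). The degrees of its steps are nondecreasing and bounded, so they are constant from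
  some \<open>J\<close> on, and the union of the tower is modular over \<open>T J\<close> by a comparison of degrees
  (\<open>modular_tower\<close>). If the union is \<open>L\<close>, this ends the search. Otherwise the union is an infinite
  proper subextension, over which the rank of \<open>L\<close> is smaller (\<open>rank_drop\<close>), and induction on the
  rank applies with the union as the new base.

  Conversely assume (i) and (ii), and suppose that the rank of \<open>K/k\<close> is unbounded. By (i) there is a
  minimal intermediate field \<open>L\<close> of unbounded rank. The field \<open>m = mod(L/k)\<close> is different from \<open>L\<close>
  by (ii), so its rank over \<open>k\<close> is bounded. By (i) the elements of exponent one in \<open>L\<close> over \<open>m\<close> form a
  finite extension of \<open>m\<close>, and modularity of \<open>L/m\<close> turns the degree of this extension into a bound
  for the rank of \<open>L\<close> over \<open>m\<close> (\<open>modular_rank_le\<close>). Bounded ranks of \<open>L/m\<close> and \<open>m/k\<close> give a bounded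
  rank of \<open>L/k\<close> (\<open>rank_le_trans\<close>), a contradiction (\<open>exists_rank_bound\<close>).
\<close>


section \<open>Preliminaries on rings and cardinals\<close>

lemma (in cring) binomial_expansion:
  assumes a: "a \<in> carrier R" and b: "b \<in> carrier R"
  shows "(a \<oplus> b) [^] (n::nat) = (\<Oplus>i\<in>{..n}. [(n choose i)] \<cdot> (a [^] i \<otimes> b [^] (n - i)))"
proof (induction n)
  case 0
  show ?case using a b by simp
next
  case (Suc n)
  let ?t = "\<lambda>n i. [(n choose i)] \<cdot> (a [^] i \<otimes> b [^] (n - i))"
  let ?u = "\<lambda>i. [(n choose i)] \<cdot> (a [^] Suc i \<otimes> b [^] (n - i))"
  let ?v = "\<lambda>i. [(n choose i)] \<cdot> (a [^] i \<otimes> b [^] (Suc n - i))"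
  have c: "?t m i \<in> carrier R" "?u i \<in> carrier R" "?v i \<in> carrier R" for m i using a b by auto
  have "(a \<oplus> b) [^] Suc n = (\<Oplus>i\<in>{..n}. ?t n i) \<otimes> a \<oplus> (\<Oplus>i\<in>{..n}. ?t n i) \<otimes> b"
    using Suc a b by (simp add: r_distr c Pi_def)
  also have "(\<Oplus>i\<in>{..n}. ?t n i) \<otimes> a = (\<Oplus>i\<in>{..n}. ?u i)"
  proof -
    have "(\<Oplus>i\<in>{..n}. ?t n i) \<otimes> a = (\<Oplus>i\<in>{..n}. ?t n i \<otimes> a)"
      using a c by (subst finsum_ldistr) (auto simp: Pi_def)
    also have "\<dots> = (\<Oplus>i\<in>{..n}. ?u i)"
      using a b c by (intro finsum_cong') (auto simp: Pi_def add_pow_ldistr add_pow_rdistr m_ac)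
    finally show ?thesis .
  qed
  also have "(\<Oplus>i\<in>{..n}. ?t n i) \<otimes> b = (\<Oplus>i\<in>{..n}. ?v i)"
  proof -
    have "(\<Oplus>i\<in>{..n}. ?t n i) \<otimes> b = (\<Oplus>i\<in>{..n}. ?t n i \<otimes> b)"
      using b c by (subst finsum_ldistr) (auto simp: Pi_def)
    also have "\<dots> = (\<Oplus>i\<in>{..n}. ?v i)"
      using a b c by (intro finsum_cong') (auto simp: Pi_def add_pow_ldistr m_assoc Suc_diff_le)
    finally show ?thesis .
  qed
  also have "(\<Oplus>i\<in>{..n}. ?u i) \<oplus> (\<Oplus>i\<in>{..n}. ?v i) = (\<Oplus>i\<in>{..Suc n}. ?t (Suc n) i)"
  proof -
    have v: "(\<Oplus>i\<in>{..n}. ?v i) = (\<Oplus>i\<in>{..Suc n}. ?v i)"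
    proof -
      have "(\<Oplus>i\<in>{..Suc n}. ?v i) = ?v (Suc n) \<oplus> (\<Oplus>i\<in>{..n}. ?v i)"
        by (rule finsum_Suc) (use c in auto)
      then show ?thesis using a b c by (simp add: binomial_eq_0 finsum_closed Pi_def)
    qed
    also have "\<dots> = (\<Oplus>i\<in>{..n}. ?v (Suc i)) \<oplus> ?v 0"
      by (rule finsum_Suc2) (use c in auto)
    finally have v': "(\<Oplus>i\<in>{..n}. ?v i) = (\<Oplus>i\<in>{..n}. ?v (Suc i)) \<oplus> ?v 0" .
    have "(\<Oplus>i\<in>{..n}. ?u i) \<oplus> (\<Oplus>i\<in>{..n}. ?v i) = ((\<Oplus>i\<in>{..n}. ?u i) \<oplus> (\<Oplus>i\<in>{..n}. ?v (Suc i))) \<oplus> ?v 0"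
      unfolding v' by (rule a_assoc[symmetric]) (use a b in \<open>auto intro!: finsum_closed\<close>)
    also have "(\<Oplus>i\<in>{..n}. ?u i) \<oplus> (\<Oplus>i\<in>{..n}. ?v (Suc i)) = (\<Oplus>i\<in>{..n}. ?u i \<oplus> ?v (Suc i))"
      using a b c by (subst finsum_addf) (auto simp: Pi_def)
    also have "\<dots> = (\<Oplus>i\<in>{..n}. ?t (Suc n) (Suc i))"
      using a b c by (intro finsum_cong') (auto simp: Pi_def add.nat_pow_mult)
    also have "?v 0 = ?t (Suc n) 0" by simp
    also have "(\<Oplus>i\<in>{..n}. ?t (Suc n) (Suc i)) \<oplus> ?t (Suc n) 0 = (\<Oplus>i\<in>{..Suc n}. ?t (Suc n) i)"
      by (rule finsum_Suc2[symmetric]) (use c in auto)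
    finally show ?thesis .
  qed
  finally show ?case .
qed

lemma (in cring) freshman_dream:
  fixes p :: nat assumes p: "prime p" and ch: "[p] \<cdot> \<one> = \<zero>" and a: "a \<in> carrier R" and b: "b \<in> carrier R"
  shows "(a \<oplus> b) [^] p = a [^] p \<oplus> b [^] p"
proof -
  have z: "[m] \<cdot> x = \<zero>" if "p dvd m" "x \<in> carrier R" for m x
  proof -
    obtain k where "m = p * k" using \<open>p dvd m\<close> by auto
    moreover have "[p] \<cdot> x = \<zero>"
      using add_pow_ldistr[of \<one> x p] ch that(2) by simp
    ultimately show ?thesis using that(2) by (simp add: add.nat_pow_pow[symmetric])
  qed
  obtain q where q: "p = Suc q" using prime_gt_0_nat[OF p] by (metis gr0_implies_Suc)
  obtain r where r: "q = Suc r" using prime_gt_1_nat[OF p] q by (metis One_nat_def Suc_less_eq gr0_implies_Suc)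
  let ?t = "\<lambda>i. [(p choose i)] \<cdot> (a [^] i \<otimes> b [^] (p - i))"
  have c: "?t i \<in> carrier R" for i using a b by auto
  have "(a \<oplus> b) [^] p = (\<Oplus>i\<in>{..p}. ?t i)" by (rule binomial_expansion[OF a b])
  also have "\<dots> = ?t p \<oplus> (\<Oplus>i\<in>{..q}. ?t i)"
    using c unfolding q by (subst finsum_Suc) (auto simp: Pi_def)
  also have "(\<Oplus>i\<in>{..q}. ?t i) = (\<Oplus>i\<in>{..r}. ?t (Suc i)) \<oplus> ?t 0"
    using c unfolding r by (subst finsum_Suc2) (auto simp: Pi_def)
  also have "(\<Oplus>i\<in>{..r}. ?t (Suc i)) = (\<Oplus>i\<in>{..r}. \<zero>)"
  proof (intro finsum_cong' refl)
    fix i assume "i \<in> {..r}"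
    then have "Suc i < p" using q r by auto
    then have "p dvd (p choose Suc i)" using p by (intro dvd_choose_prime) auto
    then show "?t (Suc i) = \<zero>" using a b by (intro z) auto
  qed auto
  finally show ?thesis using a b by simp
qed

lemma bounded_incseq_nat_const:
  fixes c :: "nat \<Rightarrow> nat"
  assumes inc: "\<And>j. c j \<le> c (Suc j)" and bd: "\<And>j. c j \<le> b"
  shows "\<exists>J. \<forall>j\<ge>J. c j = c J"
proof -
  have mono: "c i \<le> c j" if "i \<le> j" for i j using lift_Suc_mono_le[of c, OF inc that] .
  obtain J where J: "\<And>j. c j \<le> c J"
    using ex_has_greatest_nat[of "\<lambda>_. True" 0 c "Suc b"] bd by (auto simp: less_Suc_eq_le)
  have "c j = c J" if "j \<ge> J" for j using J[of j] mono[OF that] by simp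
  then show ?thesis by blast
qed

context includes cardinal_syntax begin

lemma finite_card_of_le_iff:
  fixes A B :: "'a set"
  assumes "finite A" "finite B"
  shows "|A| \<le>o |B| \<longleftrightarrow> card A \<le> card B"
proof
  assume "|A| \<le>o |B|"
  then obtain f where "inj_on f A" "f ` A \<subseteq> B" unfolding card_of_ordLeq[symmetric] by blast
  then show "card A \<le> card B" using card_inj_on_le assms by blast
next
  assume "card A \<le> card B"
  then obtain f where "f ` A \<subseteq> B" "inj_on f A" using card_le_inj[OF assms] by blast
  then show "|A| \<le>o |B|" unfolding card_of_ordLeq[symmetric] by blast
qed

end

section \<open>Powers of a monic linear polynomial\<close>

context field begin

lemma coeff_linear_mult:
  assumes x: "x \<in> carrier R" and q: "set q \<subseteq> carrier R"
  shows "coeff (poly_mult [\<one>, \<ominus> x] q) (Suc i) = coeff q i \<oplus> (\<ominus> x \<otimes> coeff q (Suc i))"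
proof -
  have m: "set (map (\<lambda>a. c \<otimes> a) q) \<subseteq> carrier R" if "c \<in> carrier R" for c using q that by auto
  have mx: "set (map (\<lambda>a. \<ominus> x \<otimes> a) q) \<subseteq> carrier R" using m x by auto
  have m1: "set (map (\<lambda>a. \<one> \<otimes> a) q @ [\<zero>]) \<subseteq> carrier R" using m[of \<one>] by auto
  have 1: "coeff (poly_mult [\<ominus> x] q) = (\<lambda>i. \<ominus> x \<otimes> coeff q i)"
    using mx x q by (simp add: poly_add_coeff scalar_coeff del: poly_add.simps)
  have "coeff (poly_mult [\<one>, \<ominus> x] q) =
      coeff (poly_add (map (\<lambda>a. \<one> \<otimes> a) q @ [\<zero>]) (poly_mult [\<ominus> x] q))"
    by (simp del: poly_add.simps)
  also have "\<dots> = (\<lambda>i. coeff (map (\<lambda>a. \<one> \<otimes> a) q @ [\<zero>]) i \<oplus> coeff (poly_mult [\<ominus> x] q) i)"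
    using m1 q x by (intro poly_add_coeff poly_mult_in_carrier) auto
  finally show ?thesis using q x
    unfolding 1 append_coeff by (simp add: scalar_coeff)
qed

abbreviation lin_pow :: "'a \<Rightarrow> nat \<Rightarrow> 'a list" where
  "lin_pow x n \<equiv> [\<one>, \<ominus> x] [^]\<^bsub>poly_ring R\<^esub> n"

lemma linear_in_poly_ring: "x \<in> carrier R \<Longrightarrow> [\<one>, \<ominus> x] \<in> carrier (poly_ring R)"
  by (auto simp: univ_poly_carrier[symmetric] polynomial_def)

lemma lin_pow_closed: "x \<in> carrier R \<Longrightarrow> lin_pow x n \<in> carrier (poly_ring R)"
  using monoid.nat_pow_closed[OF ring.is_monoid[OF univ_poly_is_ring[OF carrier_is_subring]]]
    linear_in_poly_ring by blast

lemma lin_pow_set: "x \<in> carrier R \<Longrightarrow> set (lin_pow x n) \<subseteq> carrier R"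
  using lin_pow_closed polynomial_in_carrier[OF carrier_is_subring] univ_poly_carrier by blast

lemma lin_pow_Suc: "x \<in> carrier R \<Longrightarrow> lin_pow x (Suc n) = [\<one>, \<ominus> x] \<otimes>\<^bsub>poly_ring R\<^esub> lin_pow x n"
proof -
  assume x: "x \<in> carrier R"
  interpret UP: cring "poly_ring R" using univ_poly_is_cring[OF carrier_is_subring] .
  show ?thesis using UP.m_comm[OF linear_in_poly_ring[OF x] lin_pow_closed[OF x]] by simp
qed

text \<open>
  These two coefficients are all that is needed to read off \<open>n x\<close> from
  \<open>(X - x)^n\<close>.
\<close>

lemma lin_pow_coeffs:
  assumes x: "x \<in> carrier R"
  shows "(\<forall>i>n. coeff (lin_pow x n) i = \<zero>) \<and> coeff (lin_pow x n) n = \<one> \<and>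
    (\<forall>m. n = Suc m \<longrightarrow> coeff (lin_pow x n) m = [n] \<cdot> (\<ominus> x))"
proof (induction n)
  case 0
  then show ?case by (simp add: univ_poly_one)
next
  case (Suc n)
  have set: "set (lin_pow x n) \<subseteq> carrier R"
    by (rule lin_pow_set[OF x])
  have rec: "coeff (lin_pow x (Suc n)) (Suc i) =
      coeff (lin_pow x n) i \<oplus> (\<ominus> x \<otimes> coeff (lin_pow x n) (Suc i))" for i
    unfolding lin_pow_Suc[OF x] using coeff_linear_mult[OF x set] by (simp add: univ_poly_mult del: poly_mult.simps)
  have "coeff (lin_pow x (Suc n)) i = \<zero>" if "i > Suc n" for i
    using that rec[of "i - 1"] Suc x by (cases i) auto
  moreover have "coeff (lin_pow x (Suc n)) (Suc n) = \<one>"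
    unfolding rec using Suc x by auto
  moreover have "coeff (lin_pow x (Suc n)) n = [Suc n] \<cdot> (\<ominus> x)"
  proof (cases n)
    case 0
    have "lin_pow x (Suc 0) = [\<one>, \<ominus> x]"
      using linear_in_poly_ring[OF x] monoid.nat_pow_eone[OF ring.is_monoid[OF univ_poly_is_ring[OF carrier_is_subring]]]
      by simp
    then show ?thesis using 0 x by simp
  next
    case nm: (Suc m)
    have "coeff (lin_pow x (Suc n)) n = coeff (lin_pow x n) m \<oplus> (\<ominus> x \<otimes> coeff (lin_pow x n) n)"
      using rec[of m] unfolding nm .
    also have "\<dots> = [n] \<cdot> (\<ominus> x) \<oplus> \<ominus> x"
      using Suc.IH nm x by (simp del: add.nat_pow_Suc nat_pow_Suc)
    finally show ?thesis by simp
  qed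
  ultimately show ?case by auto
qed

lemma lin_pow_degree:
  assumes x: "x \<in> carrier R"
  shows "lin_pow x n \<noteq> []" "degree (lin_pow x n) = n" "lead_coeff (lin_pow x n) = \<one>"
proof -
  note C = lin_pow_coeffs[OF x, of n]
  show ne: "lin_pow x n \<noteq> []" using C by auto
  have "lead_coeff (lin_pow x n) \<noteq> \<zero>"
    using lin_pow_closed[OF x, of n] ne by (auto simp: univ_poly_carrier[symmetric] polynomial_def)
  then have "coeff (lin_pow x n) (degree (lin_pow x n)) \<noteq> \<zero>"
    unfolding lead_coeff_simp[OF ne] .
  then have "degree (lin_pow x n) \<le> n" using C not_le by blast
  moreover have "\<not> n > degree (lin_pow x n)" using C coeff_degree[of "lin_pow x n" n] by auto
  ultimately show deg: "degree (lin_pow x n) = n" by simp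
  show "lead_coeff (lin_pow x n) = \<one>" using C lead_coeff_simp[OF ne] deg by simp
qed

lemma roots_lin_pow: "x \<in> carrier R \<Longrightarrow> roots (lin_pow x n) = replicate_mset n x"
proof (induction n)
  case 0
  then show ?case by (simp add: univ_poly_one degree_zero_imp_empty_roots univ_poly_carrier[symmetric] polynomial_def)
next
  case (Suc n)
  then show ?case
    unfolding lin_pow_Suc[OF Suc.prems]
    by (simp add: poly_mult_degree_one_monic_imp_same_roots lin_pow_closed lin_pow_degree)
qed

text \<open>
  A divisor of a product of equal linear factors splits into the same factors; the argument
  counts roots with multiplicity.
\<close>

lemma pdivides_lin_pow:
  assumes x: "x \<in> carrier R" and g: "g \<in> carrier (poly_ring R)" and mon: "lead_coeff g = \<one>"
    and dvd: "g pdivides lin_pow x n"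
  shows "g = lin_pow x (degree g)"
proof -
  interpret UP: cring "poly_ring R" using univ_poly_is_cring[OF carrier_is_subring] .
  have gz: "g \<noteq> []" using dvd zero_pdivides lin_pow_degree(1)[OF x] by metis
  have "splitted (lin_pow x n)" 
    unfolding splitted_def roots_lin_pow[OF x] lin_pow_degree(2)[OF x] by simp
  then have spl: "splitted g"
    using pdivides_imp_splitted[OF g lin_pow_closed[OF x] lin_pow_degree(1)[OF x] _ dvd] by blast
  have sub: "roots g \<subseteq># replicate_mset n x"
    using pdivides_imp_roots_incl[OF g lin_pow_closed[OF x] lin_pow_degree(1)[OF x] dvd] roots_lin_pow[OF x]
    by simp
  then have "roots g = replicate_mset (degree g) x"
    using spl unfolding splitted_def by (metis msubseteq_replicate_msetE size_replicate_mset)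
  then have "alg_mult g x = degree g" using alg_mult_eq_count_roots[OF g] by simp
  then have "lin_pow x (degree g) pdivides g" using alg_multE(1)[OF x g gz] by simp
  then obtain r where r: "r \<in> carrier (poly_ring R)" "g = lin_pow x (degree g) \<otimes>\<^bsub>poly_ring R\<^esub> r"
    unfolding pdivides_def by auto
  have pol: "polynomial (carrier R) (lin_pow x (degree g))" "polynomial (carrier R) r"
    using lin_pow_closed[OF x] r by (simp_all add: univ_poly_carrier)
  have rz: "r \<noteq> []"
  proof
    assume "r = []"
    then have "r = \<zero>\<^bsub>poly_ring R\<^esub>" by (simp add: univ_poly_zero)
    then have "g = \<zero>\<^bsub>poly_ring R\<^esub>"
      using r(2) UP.r_null[OF lin_pow_closed[OF x]] by simp
    then show False using gz by (simp add: univ_poly_zero)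
  qed
  have "degree g = degree g + degree r"
    using poly_mult_degree_eq[OF carrier_is_subring pol] r(2) lin_pow_degree[OF x] rz
    by (metis univ_poly_mult)
  then obtain c where c: "r = [c]" using rz by (cases r) auto
  have "lead_coeff g = lead_coeff (lin_pow x (degree g)) \<otimes> lead_coeff r"
    using poly_mult_lead_coeff[OF carrier_is_subring pol lin_pow_degree(1)[OF x] rz] r(2)
    by (metis univ_poly_mult)
  moreover have "c \<in> carrier R" using r(1) c by (auto simp: univ_poly_carrier[symmetric] polynomial_def)
  ultimately have "c = \<one>" using mon lin_pow_degree(3)[OF x] c by simp
  then have "r = \<one>\<^bsub>poly_ring R\<^esub>" using c by (simp add: univ_poly_one)
  then show ?thesis
    using r(2) UP.r_one[OF lin_pow_closed[OF x]] by simp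
qed

section \<open>Subfields and adjunction\<close>

lemma subfield_carrier: "subfield F R \<Longrightarrow> x \<in> F \<Longrightarrow> x \<in> carrier R"
  using subfieldE(3) by blast

lemma subfieldI_closed:
  assumes "F \<subseteq> carrier R" "\<one> \<in> F" "\<And>x. x \<in> F \<Longrightarrow> \<ominus> x \<in> F"
    "\<And>x y. x \<in> F \<Longrightarrow> y \<in> F \<Longrightarrow> x \<oplus> y \<in> F" "\<And>x y. x \<in> F \<Longrightarrow> y \<in> F \<Longrightarrow> x \<otimes> y \<in> F"
    "\<And>x. x \<in> F \<Longrightarrow> x \<noteq> \<zero> \<Longrightarrow> inv x \<in> F"
  shows "subfield F R"
  using assms by (intro subfieldI' subringI) auto

lemma subfield_props:
  assumes "subfield F R"
  shows "F \<subseteq> carrier R" "\<one> \<in> F" "\<zero> \<in> F" "\<And>x. x \<in> F \<Longrightarrow> \<ominus> x \<in> F"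
    "\<And>x y. x \<in> F \<Longrightarrow> y \<in> F \<Longrightarrow> x \<oplus> y \<in> F" "\<And>x y. x \<in> F \<Longrightarrow> y \<in> F \<Longrightarrow> x \<otimes> y \<in> F"
    "\<And>x. x \<in> F \<Longrightarrow> x \<noteq> \<zero> \<Longrightarrow> inv x \<in> F"
    "\<And>x (m::nat). x \<in> F \<Longrightarrow> x [^] m \<in> F"
proof -
  note S = subringE[OF subfieldE(1)[OF assms]]
  show "F \<subseteq> carrier R" "\<one> \<in> F" "\<zero> \<in> F" "\<And>x. x \<in> F \<Longrightarrow> \<ominus> x \<in> F"
    "\<And>x y. x \<in> F \<Longrightarrow> y \<in> F \<Longrightarrow> x \<oplus> y \<in> F" "\<And>x y. x \<in> F \<Longrightarrow> y \<in> F \<Longrightarrow> x \<otimes> y \<in> F"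
    using S by auto
  show "\<And>x. x \<in> F \<Longrightarrow> x \<noteq> \<zero> \<Longrightarrow> inv x \<in> F" using subfield_m_inv[OF assms] by auto
  show "x [^] m \<in> F" if "x \<in> F" for x and m :: nat
    by (induction m) (use S that in auto)
qed

lemma subfield_Inter:
  assumes "\<And>F. F \<in> \<F> \<Longrightarrow> subfield F R" "\<F> \<noteq> {}"
  shows "subfield (\<Inter>\<F>) R"
proof (rule subfieldI_closed)
  note P = subfield_props[OF assms(1)]
  show "\<Inter>\<F> \<subseteq> carrier R" using P(1) assms(2) by blast
  show "\<one> \<in> \<Inter>\<F>" using P(2) by blast
  show "\<ominus> x \<in> \<Inter>\<F>" if "x \<in> \<Inter>\<F>" for x using P(4) that by blast
  show "x \<oplus> y \<in> \<Inter>\<F>" if "x \<in> \<Inter>\<F>" "y \<in> \<Inter>\<F>" for x y using P(5) that by blast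
  show "x \<otimes> y \<in> \<Inter>\<F>" if "x \<in> \<Inter>\<F>" "y \<in> \<Inter>\<F>" for x y using P(6) that by blast
  show "inv x \<in> \<Inter>\<F>" if "x \<in> \<Inter>\<F>" "x \<noteq> \<zero>" for x using P(7) that by blast
qed

lemma subfield_Int: "subfield F R \<Longrightarrow> subfield G R \<Longrightarrow> subfield (F \<inter> G) R"
  using subfield_Inter[of "{F, G}"] by auto

lemma subfield_chain_Union:
  assumes sub: "\<And>n. subfield (T n) R" and inc: "\<And>n::nat. T n \<subseteq> T (Suc n)"
  shows "subfield (\<Union>n. T n) R"
proof -
  have mono: "T m \<subseteq> T n" if "m \<le> n" for m n using lift_Suc_mono_le[of T, OF inc that] .
  have two: "\<exists>n. x \<in> T n \<and> y \<in> T n" if xy: "x \<in> (\<Union>n. T n)" "y \<in> (\<Union>n. T n)" for x y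
  proof -
    obtain a b where "x \<in> T a" "y \<in> T b" using xy by auto
    then have "x \<in> T (max a b)" "y \<in> T (max a b)" using mono[of a "max a b"] mono[of b "max a b"] by auto
    then show ?thesis by blast
  qed
  show ?thesis
  proof (rule subfieldI_closed)
    show "x \<oplus> y \<in> (\<Union>n. T n)" if xy: "x \<in> (\<Union>n. T n)" "y \<in> (\<Union>n. T n)" for x y
      using two[OF xy] subfield_props(5)[OF sub] by blast
    show "x \<otimes> y \<in> (\<Union>n. T n)" if xy: "x \<in> (\<Union>n. T n)" "y \<in> (\<Union>n. T n)" for x y
      using two[OF xy] subfield_props(6)[OF sub] by blast
    show "(\<Union>n. T n) \<subseteq> carrier R" using subfield_props(1)[OF sub] by blast
    show "\<one> \<in> (\<Union>n. T n)" using subfield_props(2)[OF sub] by blast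
    show "\<ominus> x \<in> (\<Union>n. T n)" if "x \<in> (\<Union>n. T n)" for x
      using that subfield_props(4)[OF sub] by blast
    show "inv x \<in> (\<Union>n. T n)" if "x \<in> (\<Union>n. T n)" "x \<noteq> \<zero>" for x
      using that subfield_props(7)[OF sub] by blast
  qed
qed

abbreviation adj :: "'a set \<Rightarrow> 'a set \<Rightarrow> 'a set" where "adj \<equiv> adjoin R"

lemma adj_subfield: "F \<subseteq> carrier R \<Longrightarrow> S \<subseteq> carrier R \<Longrightarrow> subfield (adj F S) R"
  unfolding adjoin_def by (rule generate_field_is_subfield) auto

lemma adj_carrier: "F \<subseteq> carrier R \<Longrightarrow> S \<subseteq> carrier R \<Longrightarrow> adj F S \<subseteq> carrier R"
  using adj_subfield subfieldE(3) by blast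

lemma adj_base: "F \<subseteq> adj F S" and adj_gens: "S \<subseteq> adj F S"
  unfolding adjoin_def by (auto intro: generate_field.incl)

lemma adj_least: "subfield E R \<Longrightarrow> F \<subseteq> E \<Longrightarrow> S \<subseteq> E \<Longrightarrow> adj F S \<subseteq> E"
  unfolding adjoin_def by (intro generate_field_min_subfield1) (auto intro: subfield_carrier)

lemma adj_mono: "F \<subseteq> G \<Longrightarrow> S \<subseteq> T \<Longrightarrow> G \<subseteq> carrier R \<Longrightarrow> T \<subseteq> carrier R \<Longrightarrow> adj F S \<subseteq> adj G T"
  unfolding adjoin_def by (intro mono_generate_field) auto

lemma adj_adj: "F \<subseteq> carrier R \<Longrightarrow> S \<subseteq> carrier R \<Longrightarrow> T \<subseteq> carrier R \<Longrightarrow> adj (adj F S) T = adj F (S \<union> T)"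
proof (rule antisym)
  assume c: "F \<subseteq> carrier R" "S \<subseteq> carrier R" "T \<subseteq> carrier R"
  show "adj (adj F S) T \<subseteq> adj F (S \<union> T)"
    using c adj_gens[of "S \<union> T" F] adj_base[of F "S \<union> T"]
    by (intro adj_least adj_subfield) auto
  show "adj F (S \<union> T) \<subseteq> adj (adj F S) T"
    using c adj_gens[of S F] adj_base[of F S] adj_base[of "adj F S" T] adj_gens[of T "adj F S"]
    by (intro adj_least adj_subfield adj_carrier) auto
qed

lemma adj_absorb: "subfield F R \<Longrightarrow> S \<subseteq> F \<Longrightarrow> adj F S = F"
  by (rule antisym[OF adj_least adj_base]) auto

lemma adj_empty: "subfield F R \<Longrightarrow> adj F {} = F"
  using adj_absorb by simp

lemma adj_insert: "F \<subseteq> carrier R \<Longrightarrow> x \<in> carrier R \<Longrightarrow> S \<subseteq> carrier R \<Longrightarrow> adj F (insert x S) = adj (adj F {x}) S"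
  by (simp add: adj_adj)

text \<open>
  The elements generated by finite subsets already form a field.
\<close>

lemma adj_finite_support:
  assumes F: "F \<subseteq> carrier R" and S: "S \<subseteq> carrier R" and y: "y \<in> adj F S"
  shows "\<exists>T. finite T \<and> T \<subseteq> S \<and> y \<in> adj F T"
proof -
  let ?V = "{y. \<exists>T. finite T \<and> T \<subseteq> S \<and> y \<in> adj F T}"
  have sf: "subfield (adj F T) R" if "T \<subseteq> S" for T using that S F by (intro adj_subfield) auto
  have two: "\<exists>T. finite T \<and> T \<subseteq> S \<and> a \<in> adj F T \<and> b \<in> adj F T" if ab: "a \<in> ?V" "b \<in> ?V" for a b
  proof -
    obtain T U where TU: "finite T" "T \<subseteq> S" "a \<in> adj F T" "finite U" "U \<subseteq> S" "b \<in> adj F U"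
      using ab by auto
    moreover have "adj F T \<subseteq> adj F (T \<union> U)" "adj F U \<subseteq> adj F (T \<union> U)"
      using TU S F by (auto intro!: adj_mono del: subsetI)
    ultimately show ?thesis by (intro exI[of _ "T \<union> U"]) auto
  qed
  have one: "\<exists>T. finite T \<and> T \<subseteq> S \<and> a \<in> adj F T" if "a \<in> F \<or> a \<in> S \<or> a = \<one>" for a
  proof (cases "a \<in> S")
    case True
    then show ?thesis using adj_gens[of "{a}" F] by (intro exI[of _ "{a}"]) auto
  next
    case False
    then show ?thesis using that adj_base[of F "{}"] subfield_props(2)[OF sf, of "{}"] by (intro exI[of _ "{}"]) auto
  qed
  have "subfield ?V R"
  proof (rule subfieldI_closed)
    show "?V \<subseteq> carrier R" using subfield_props(1)[OF sf] by blast
    show "\<one> \<in> ?V" using one by blast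
    show "\<ominus> x \<in> ?V" if "x \<in> ?V" for x using that subfield_props(4)[OF sf] by blast
    show "inv x \<in> ?V" if "x \<in> ?V" "x \<noteq> \<zero>" for x using that subfield_props(7)[OF sf] by blast
    show "x \<oplus> z \<in> ?V" if xz: "x \<in> ?V" "z \<in> ?V" for x z
      using two[OF xz] subfield_props(5)[OF sf] by blast
    show "x \<otimes> z \<in> ?V" if xz: "x \<in> ?V" "z \<in> ?V" for x z
      using two[OF xz] subfield_props(6)[OF sf] by blast
  qed
  then have "adj F S \<subseteq> ?V" by (rule adj_least) (use one in blast)+
  then show ?thesis using y by blast
qed

lemma adj_eq_simple_extension:
  assumes F: "subfield F R" and x: "x \<in> carrier R" and alg: "(algebraic over F) x"
  shows "adj F {x} = simple_extension F x"
proof (rule antisym)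
  note S = subfieldE(1)[OF F] and c = subfieldE(3)[OF F]
  show "adj F {x} \<subseteq> simple_extension F x"
    using simple_extension_is_subfield[OF F x] alg simple_extension_incl[OF c x] simple_extension_mem[OF S x]
    by (intro adj_least) auto
  show "simple_extension F x \<subseteq> adj F {x}"
    using adj_base[of F "{x}"] adj_gens[of "{x}" F] x c
    by (intro simple_extension_subring_incl subfieldE(1) adj_subfield) auto
qed

section \<open>Degrees of field extensions\<close>

lemma subfield_subalgebra: "subfield M R \<Longrightarrow> F \<subseteq> M \<Longrightarrow> subalgebra F M R"
  using subringE(6)[OF subfieldE(1)] subring.axioms(1)[OF subfieldE(1)]
  by (auto intro!: subalgebra.intro subalgebra_axioms.intro)

lemma deg_tower:
  assumes "subfield F R" "subfield E R" "finite_dimension F E" "finite_dimension E M"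
  shows "finite_dimension F M" "dim F M = dim F E * dim E M"
  using telescopic_base_dim[OF assms] by (simp_all add: over_def)

lemma dim_dimension: "subfield F R \<Longrightarrow> finite_dimension F E \<Longrightarrow> dimension (dim F E) F E"
  using finite_dimensionE by (simp add: over_def)

lemma dim_eqI: "subfield F R \<Longrightarrow> dimension n F E \<Longrightarrow> dim F E = n"
  using dimI by (simp add: over_def)

lemma mono_Span_field:
  assumes F: "subfield F R" and E: "subfield E R" and FE: "F \<subseteq> E" and Us: "set Us \<subseteq> carrier R"
  shows "Span F Us \<subseteq> Span E Us"
  unfolding Span_eq_combine_set[OF F Us] Span_eq_combine_set[OF E Us] using FE by blast

lemma finite_dimension_tower:
  assumes F: "subfield F R" and E: "subfield E R" and M: "subfield M R"
    and "F \<subseteq> E" "E \<subseteq> M" and fin: "finite_dimension F M"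
  shows "finite_dimension F E" "finite_dimension E M"
proof -
  show "finite_dimension F E"
    using subalbegra_incl_imp_finite_dimension[OF F fin subfield_subalgebra[OF E \<open>F \<subseteq> E\<close>] \<open>E \<subseteq> M\<close>] .
  obtain Us where Us: "set Us \<subseteq> carrier R" "Span F Us = M"
    using exists_base[OF F dim_dimension[OF F fin]] by blast
  have "set Us \<subseteq> M" using Span_base_incl[OF F Us(1)] Us(2) by simp
  then have "Span E Us = M"
    using mono_Span_field[OF F E \<open>F \<subseteq> E\<close> Us(1)] Us(2)
      subalgebra_Span_incl[OF E subfield_subalgebra[OF M \<open>E \<subseteq> M\<close>], of Us] by simp
  then show "finite_dimension E M" using Span_finite_dimension[OF E Us(1)] by simp
qed

text \<open>
  Counting a spanning list both bounds the dimension and, in the case of equality, certifies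
  independence.
\<close>

lemma dim_Span:
  assumes F: "subfield F R" and Us: "set Us \<subseteq> carrier R"
  shows "\<exists>n\<le>length Us. dimension n F (Span F Us) \<and> (n = length Us \<longrightarrow> independent F Us)"
  using Us
proof (induction Us)
  case Nil
  then show ?case by auto
next
  case (Cons u Us)
  then obtain n where n: "n \<le> length Us" "dimension n F (Span F Us)" "n = length Us \<longrightarrow> independent F Us"
    by auto
  show ?case
  proof (cases "u \<in> Span F Us")
    case True
    have "Span F (u # Us) \<subseteq> Span F Us"
      using True Cons.prems Span_base_incl[OF F, of Us] by (intro mono_Span_subset[OF F]) auto
    then have "Span F (u # Us) = Span F Us" using mono_Span[OF F, of Us u] Cons.prems by auto
    then show ?thesis using n by (intro exI[of _ n]) simp
  next
    case False
    have "dimension (Suc n) F (Span F (u # Us))"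
      using Suc_dim[OF _ False n(2)] Cons.prems by simp
    then show ?thesis using n False Cons.prems li_Cons[of u F Us]
      by (intro exI[of _ "Suc n"]) auto
  qed
qed

lemma dim_Span_le:
  assumes "subfield F R" "set Us \<subseteq> carrier R"
  shows "dim F (Span F Us) \<le> length Us"
  using dim_Span[OF assms] dim_eqI[OF assms(1)] by auto

lemma independent_of_dim:
  assumes "subfield F R" "set Us \<subseteq> carrier R" "dim F (Span F Us) = length Us"
  shows "independent F Us"
  using dim_Span[OF assms(1,2)] dim_eqI[OF assms(1)] assms(3) by auto

lemma dim_pos:
  assumes "subfield F R" "subfield M R" "finite_dimension F M"
  shows "0 < dim F M"
proof (rule ccontr)
  assume "\<not> 0 < dim F M"
  then have "M = {\<zero>}" using dimension_zero[OF assms(1)] dim_dimension[OF assms(1,3)] by simp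
  then show False using subringE(3)[OF subfieldE(1)[OF assms(2)]] by auto
qed

lemma dim_one_imp_eq:
  assumes F: "subfield F R" and M: "subfield M R" and FM: "F \<subseteq> M" and d: "finite_dimension F M" "dim F M = 1"
  shows "M = F"
proof -
  have M1: "dimension 1 F M" using dim_dimension[OF F d(1)] d(2) by simp
  obtain Us where Us: "set Us \<subseteq> carrier R" "independent F Us" "length Us = 1" "Span F Us = F"
    using exists_base[OF F dimension_one[OF F]] by blast
  have "set Us \<subseteq> M" using Span_base_incl[OF F Us(1)] Us(4) FM by simp
  then show ?thesis using independent_length_eq_dimension[OF F M1 Us(2)] Us(3,4) by simp
qed

section \<open>Linear disjointness\<close>

lemma independent_anti:
  assumes C: "subfield C R" and B: "subfield B R" and CB: "C \<subseteq> B" and "independent B Us"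
  shows "independent C Us"
  using assms(4)
proof (induction Us rule: list.induct)
  case (Cons u Us)
  note i = independent_backwards[OF Cons.prems]
  have "u \<notin> Span C Us" using i(1) mono_Span_field[OF C B CB independent_in_carrier[OF i(2)]] by blast
  then show ?case using i Cons.IH by (intro li_Cons)
qed simp

lemma combine_in_subfield:
  "subfield B R \<Longrightarrow> set cs \<subseteq> B \<Longrightarrow> set vs \<subseteq> B \<Longrightarrow> combine cs vs \<in> B"
  by (induction cs vs rule: combine.induct)
    (auto intro: subringE(2,6,7)[OF subfieldE(1)])

lemma combine_in_Span:
  assumes B: "subfield B R" and Us: "set Us \<subseteq> carrier R"
  shows "set as \<subseteq> Span B Us \<Longrightarrow> set vs \<subseteq> B \<Longrightarrow> combine as vs \<in> Span B Us"
proof (induction as vs rule: combine.induct)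
  case (1 a as v vs)
  have "a \<in> carrier R" "v \<in> carrier R"
    using 1 Span_subgroup_props(1)[OF B Us] subfieldE(3)[OF B] by auto
  then have "a \<otimes> v = v \<otimes> a" by (rule m_comm)
  then show ?case using 1 Span_subgroup_props(3)[OF B Us] Span_smult_closed[OF B Us, of v a] by simp
qed (use Span_subgroup_props(2)[OF B Us] in auto)

text \<open>
  Expanding every coefficient of a combination along the first vector of a basis separates off
  one combination with coefficients in the small field; this is the step of the induction that
  compares coefficients in a tensor product.
\<close>

lemma combine_split_head:
  assumes C: "subfield C R" and u: "u \<in> carrier R" and Us: "set Us \<subseteq> carrier R"
    and "length as = length vs" "set as \<subseteq> Span C (u # Us)" "set vs \<subseteq> carrier R"
  shows "\<exists>cs as'. length cs = length vs \<and> length as' = length vs \<and> set cs \<subseteq> C \<and> set as' \<subseteq> Span C Us \<and>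
    combine as vs = combine cs vs \<otimes> u \<oplus> combine as' vs \<and> (set cs \<subseteq> {\<zero>} \<longrightarrow> as = as')"
  using assms(4-6)
proof (induction as vs rule: list_induct2)
  case Nil
  then show ?case using u by (intro exI[of _ "[]"]) simp
next
  case (Cons a as v vs)
  then obtain cs as' where IH: "length cs = length vs" "length as' = length vs" "set cs \<subseteq> C"
    "set as' \<subseteq> Span C Us" "combine as vs = combine cs vs \<otimes> u \<oplus> combine as' vs" "set cs \<subseteq> {\<zero>} \<longrightarrow> as = as'"
    by auto
  have "a \<in> line_extension C u (Span C Us)" using Cons.prems by simp
  then obtain c a' where c: "c \<in> C" "a' \<in> Span C Us" "a = c \<otimes> u \<oplus> a'"
    unfolding line_extension_mem_iff by blast
  have car: "c \<in> carrier R" "a' \<in> carrier R" "v \<in> carrier R" "set cs \<subseteq> carrier R" "set as' \<subseteq> carrier R" "set vs \<subseteq> carrier R"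
    using c IH Cons.prems subfieldE(3)[OF C] Span_subgroup_props(1)[OF C Us] by auto
  define s t where "s = combine cs vs" and "t = combine as' vs"
  have st: "s \<in> carrier R" "t \<in> carrier R" using car by (auto simp: s_def t_def)
  have "combine (a # as) (v # vs) = (c \<otimes> u \<oplus> a') \<otimes> v \<oplus> (s \<otimes> u \<oplus> t)"
    using IH(5) c(3) by (simp add: s_def t_def)
  also have "\<dots> = (c \<otimes> v \<oplus> s) \<otimes> u \<oplus> (a' \<otimes> v \<oplus> t)"
    using car(1-3) st u by algebra
  finally have eq: "combine (a # as) (v # vs) =
      combine (c # cs) (v # vs) \<otimes> u \<oplus> combine (a' # as') (v # vs)"
    by (simp add: s_def t_def)
  moreover have "set (c # cs) \<subseteq> {\<zero>} \<longrightarrow> a # as = a' # as'"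
    using IH(6) c car u by auto
  ultimately show ?case using IH c
    by (intro exI[of _ "c # cs"] exI[of _ "a' # as'"]) auto
qed

text \<open>
  The tensor product over \<open>C\<close> of the span of \<open>Us\<close> with
  \<open>B\<close> embeds into the field: expand the coefficients in the basis
  \<open>Us\<close>, and compare.
\<close>

lemma combine_trivial_of_independent:
  assumes B: "subfield B R" and C: "subfield C R" and CB: "C \<subseteq> B"
    and vs: "set vs \<subseteq> B" "independent C vs"
  shows "independent B Us \<Longrightarrow> length as = length vs \<Longrightarrow> set as \<subseteq> Span C Us \<Longrightarrow> combine as vs = \<zero> \<Longrightarrow>
    set as \<subseteq> {\<zero>}"
proof (induction Us arbitrary: as)
  case (Cons u Us)
  note i = independent_backwards[OF Cons.prems(1)]
  note Us = independent_in_carrier[OF i(2)]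
  have vc: "set vs \<subseteq> carrier R" using vs subfieldE(3)[OF B] by blast
  obtain cs as' where D: "length cs = length vs" "length as' = length vs" "set cs \<subseteq> C"
    "set as' \<subseteq> Span C Us" "combine as vs = combine cs vs \<otimes> u \<oplus> combine as' vs" "set cs \<subseteq> {\<zero>} \<longrightarrow> as = as'"
    using combine_split_head[OF C i(3) Us Cons.prems(2,3) vc] by blast
  let ?s = "combine cs vs" and ?t = "combine as' vs"
  have s: "?s \<in> B" using D(3) CB vs(1) by (intro combine_in_subfield[OF B]) auto
  have t: "?t \<in> Span B Us"
    using D(4) mono_Span_field[OF C B CB Us] vs(1) by (intro combine_in_Span[OF B Us]) auto
  have sc: "?s \<in> carrier R" "?t \<in> carrier R"
    using s t subfieldE(3)[OF B] Span_subgroup_props(1)[OF B Us] by auto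
  have s0: "?s = \<zero>"
  proof (rule ccontr)
    assume nz: "?s \<noteq> \<zero>"
    have "?s \<otimes> u = \<ominus> ?t" using D(5) Cons.prems(4) sc i(3) minus_equality by simp
    then have "?s \<otimes> u \<in> Span B Us" using Span_subgroup_props(4)[OF B Us t] by simp
    then have "u \<in> Span B Us" using Span_m_inv_simprule[OF B Us _ i(3)] s nz by blast
    then show False using i(1) by blast
  qed
  have "set (take (length vs) cs) \<subseteq> {\<zero>}"
    by (rule independent_imp_trivial_combine[OF C vs(2) D(3) s0])
  then have "as = as'" using D(1,6) by simp
  then show ?case using Cons.IH[OF i(2) Cons.prems(2)] D(4) Cons.prems(4) by simp
qed auto

text \<open>
  One suitable basis suffices to verify linear disjointness, with the two fields exchanged.
\<close>

lemma linearly_disjoint_of_basis: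
  assumes A: "subfield A R" and B: "subfield B R" and C: "subfield C R" and CA: "C \<subseteq> A" and CB: "C \<subseteq> B"
    and basis: "\<And>as. set as \<subseteq> A \<Longrightarrow> \<exists>Us. independent B Us \<and> set as \<subseteq> Span C Us"
  shows "linearly_disjoint R C B A"
  unfolding linearly_disjoint_def
proof (intro allI impI)
  fix vs assume vs: "set vs \<subseteq> B \<and> independent C vs"
  have vc: "set vs \<subseteq> carrier R" using vs subfieldE(3)[OF B] by blast
  show "independent A vs"
  proof (rule trivial_combine_imp_independent[OF A vc])
    fix Ks assume Ks: "set Ks \<subseteq> A" "combine Ks vs = \<zero>"
    have Kc: "set Ks \<subseteq> carrier R" using Ks subfieldE(3)[OF A] by blast
    obtain Ks' where K: "set (take (length vs) Ks) \<subseteq> set Ks'"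
      "set Ks' \<subseteq> set (take (length vs) Ks) \<union> {\<zero>}" "length Ks' = length vs" "combine Ks' vs = \<zero>"
      using combine_normalize[OF Kc vc Ks(2)] .
    have "set Ks' \<subseteq> A"
      using K(2) Ks(1) subringE(2)[OF subfieldE(1)[OF A]] by (auto dest: in_set_takeD)
    then obtain Us where Us: "independent B Us" "set Ks' \<subseteq> Span C Us" using basis by blast
    have "set Ks' \<subseteq> {\<zero>}"
      by (rule combine_trivial_of_independent[OF B C CB _ _ Us(1) K(3) Us(2) K(4)]) (use vs in auto)
    then show "set (take (length vs) Ks) \<subseteq> {\<zero>}" using K(1) by blast
  qed
qed

lemma linearly_disjoint_sym:
  assumes A: "subfield A R" and B: "subfield B R" and C: "subfield C R" and CA: "C \<subseteq> A" and CB: "C \<subseteq> B"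
    and ld: "linearly_disjoint R C A B"
  shows "linearly_disjoint R C B A"
proof (rule linearly_disjoint_of_basis[OF A B C CA CB])
  fix as assume as: "set as \<subseteq> A"
  then have ac: "set as \<subseteq> carrier R" using subfieldE(3)[OF A] by blast
  obtain Us where Us: "set Us \<subseteq> carrier R" "independent C Us" "Span C Us = Span C as"
    using filter_base[OF C ac] .
  have "set Us \<subseteq> A"
    using Span_base_incl[OF C Us(1)] Us(3) subalgebra_Span_incl[OF C subfield_subalgebra[OF A CA] as] by simp
  then have "independent B Us" using ld Us(2) by (simp add: linearly_disjoint_def)
  then show "\<exists>Us. independent B Us \<and> set as \<subseteq> Span C Us"
    using Span_base_incl[OF C ac] Us(3) by auto
qed

lemma linearly_disjoint_right_base: "linearly_disjoint R C A C"
  by (simp add: linearly_disjoint_def)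

lemma linearly_disjoint_left_base:
  "subfield C R \<Longrightarrow> subfield B R \<Longrightarrow> C \<subseteq> B \<Longrightarrow> linearly_disjoint R C C B"
  using linearly_disjoint_sym[of B C C] linearly_disjoint_right_base by auto

text \<open>
  With the roles of the fields exchanged, a relation with coefficients in \<open>A\<close>
  expresses one vector through independent others. The coefficients are then unique, so
  relations over \<open>A \<inter> M\<close> and over \<open>A \<inter> N\<close> must coincide.
  This makes modularity stable under intersection.
\<close>

lemma linearly_disjoint_Int:
  assumes A: "subfield A R" and M: "subfield M R" and N: "subfield N R"
    and ld: "linearly_disjoint R (A \<inter> M) A M" "linearly_disjoint R (A \<inter> N) A N"
  shows "linearly_disjoint R (A \<inter> (M \<inter> N)) A (M \<inter> N)"
proof -
  let ?D = "A \<inter> (M \<inter> N)"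
  have D: "subfield ?D R" and mn: "subfield (M \<inter> N) R" and am: "subfield (A \<inter> M) R" "subfield (A \<inter> N) R"
    using A M N by (auto intro!: subfield_Int)
  have ldM: "independent A vs" if "set vs \<subseteq> M" "independent (A \<inter> M) vs" for vs
    using linearly_disjoint_sym[OF A M am(1) _ _ ld(1)] that by (simp add: linearly_disjoint_def)
  have ldN: "independent A vs" if "set vs \<subseteq> N" "independent (A \<inter> N) vs" for vs
    using linearly_disjoint_sym[OF A N am(2) _ _ ld(2)] that by (simp add: linearly_disjoint_def)
  have "independent A vs" if "set vs \<subseteq> M \<inter> N" "independent ?D vs" for vs
    using that
  proof (induction vs)
    case (Cons v vs)
    note i = independent_backwards[OF Cons.prems(2)]
    have IH: "independent A vs" using Cons i by auto
    note vc = independent_in_carrier[OF i(2)]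
    have "v \<notin> Span A vs"
    proof
      assume v: "v \<in> Span A vs"
      have coeffs: "\<exists>bs. set bs \<subseteq> A \<inter> E \<and> length bs = length vs \<and> v = combine bs vs"
        if E: "subfield (A \<inter> E) R" "set (v # vs) \<subseteq> E"
          and l: "\<And>vs. set vs \<subseteq> E \<Longrightarrow> independent (A \<inter> E) vs \<Longrightarrow> independent A vs" for E
      proof -
        have "\<not> independent (A \<inter> E) (v # vs)" using l[of "v # vs"] E v independent_backwards(1) by blast
        then have "v \<in> Span (A \<inter> E) vs"
          using independent_anti[OF E(1) A _ IH] i(3) li_Cons by blast
        then show ?thesis using Span_mem_iff_length_version[OF E(1) vc] by blast
      qed
      obtain bs where bs: "set bs \<subseteq> A \<inter> M" "length bs = length vs" "v = combine bs vs"
        using coeffs[of M] am Cons.prems ldM by auto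
      obtain cs where cs: "set cs \<subseteq> A \<inter> N" "length cs = length vs" "v = combine cs vs"
        using coeffs[of N] am Cons.prems ldN by auto
      have "bs = cs" using unique_decomposition[OF A IH v] bs cs by (metis le_inf_iff)
      then have "v \<in> Span ?D vs"
        using bs cs Span_mem_iff_length_version[OF D vc, of v] by blast
      then show False using i(1) by blast
    qed
    then show ?case using i(3) IH by (intro li_Cons)
  qed simp
  then have "linearly_disjoint R ?D (M \<inter> N) A" by (simp add: linearly_disjoint_def)
  then show ?thesis by (rule linearly_disjoint_sym[OF mn A D, rotated 2]) auto
qed

section \<open>Strict towers of simple extensions\<close>

text \<open>
  The length of such a sequence bounds the degree of a finite extension from below, and longest
  sequences generate; this replaces the computation of degrees wherever only bounds matter.
\<close>

primrec strict_tower :: "'a set \<Rightarrow> 'a list \<Rightarrow> bool" where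
  "strict_tower F [] = True"
| "strict_tower F (x # xs) = (x \<notin> F \<and> strict_tower (adj F {x}) xs)"

lemma strict_tower_anti: "F \<subseteq> G \<Longrightarrow> G \<subseteq> carrier R \<Longrightarrow> set xs \<subseteq> carrier R \<Longrightarrow> strict_tower G xs \<Longrightarrow> strict_tower F xs"
proof (induction xs arbitrary: F G)
  case (Cons x xs)
  have "adj F {x} \<subseteq> adj G {x}" using Cons.prems by (intro adj_mono) auto
  moreover have "adj G {x} \<subseteq> carrier R" using Cons.prems by (intro adj_carrier) auto
  ultimately show ?case using Cons.IH[of "adj F {x}" "adj G {x}"] Cons.prems by auto
qed simp

lemma strict_tower_append:
  "subfield F R \<Longrightarrow> set xs \<subseteq> carrier R \<Longrightarrow> set ys \<subseteq> carrier R \<Longrightarrow>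
    strict_tower F (xs @ ys) \<longleftrightarrow> strict_tower F xs \<and> strict_tower (adj F (set xs)) ys"
proof (induction xs arbitrary: F)
  case (Cons x xs)
  have c: "F \<subseteq> carrier R" using subfieldE(3) Cons.prems by blast
  then have "subfield (adj F {x}) R" using Cons.prems by (intro adj_subfield) auto
  then show ?case using Cons adj_insert[OF c, of x "set xs"] by auto
qed (simp add: adj_empty)

text \<open>
  Every strict step at least doubles the degree.
\<close>

lemma strict_tower_length:
  "subfield F R \<Longrightarrow> subfield E R \<Longrightarrow> F \<subseteq> E \<Longrightarrow> set xs \<subseteq> E \<Longrightarrow> finite_dimension F E \<Longrightarrow> strict_tower F xs \<Longrightarrow>
    length xs < dim F E"
proof (induction xs arbitrary: F)
  case Nil
  then show ?case using dim_pos by simp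
next
  case (Cons x xs)
  let ?G = "adj F {x}"
  have x: "x \<in> carrier R" "F \<subseteq> carrier R" using Cons.prems subfieldE(3) by auto
  have G: "subfield ?G R" using x by (intro adj_subfield) auto
  have GE: "?G \<subseteq> E" using Cons.prems by (intro adj_least) auto
  note fin = finite_dimension_tower[OF Cons.prems(1) G Cons.prems(2) adj_base GE Cons.prems(5)]
  have IH: "length xs < dim ?G E" using Cons G GE fin by auto
  have "?G \<noteq> F" using Cons.prems adj_gens[of "{x}" F] by auto
  then have "dim F ?G \<noteq> 1" using dim_one_imp_eq[OF Cons.prems(1) G adj_base fin(1)] by auto
  then have "2 \<le> dim F ?G" using dim_pos[OF Cons.prems(1) G fin(1)] by linarith
  then have "2 * dim ?G E \<le> dim F E"
    using deg_tower(2)[OF Cons.prems(1) G fin] by simp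
  then show ?case using IH by simp
qed

lemma strict_tower_generators:
  assumes G: "subfield G R" and L: "subfield L R" and GL: "G \<subseteq> L"
    and bd: "\<And>xs. set xs \<subseteq> L \<Longrightarrow> strict_tower G xs \<Longrightarrow> length xs \<le> q"
  shows "\<exists>ws. set ws \<subseteq> L \<and> length ws \<le> q \<and> strict_tower G ws \<and> adj G (set ws) = L"
proof -
  define P where "P = (\<lambda>xs. set xs \<subseteq> L \<and> strict_tower G xs)"
  have "P []" by (simp add: P_def)
  moreover have "\<forall>y. P y \<longrightarrow> length y < Suc q" using bd by (force simp: P_def)
  ultimately obtain ws where ws: "P ws" "\<And>ys. P ys \<Longrightarrow> length ys \<le> length ws"
    using ex_has_greatest_nat[of P "[]" length "Suc q"] by blast
  have c: "L \<subseteq> carrier R" using subfieldE(3)[OF L] .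
  have wsL: "set ws \<subseteq> L" and wsi: "strict_tower G ws" using ws(1) by (auto simp: P_def)
  have "y \<in> adj G (set ws)" if y: "y \<in> L" for y
  proof (rule ccontr)
    assume "y \<notin> adj G (set ws)"
    then have "strict_tower G (ws @ [y])"
      using wsi subsetD[OF c y] by (simp add: strict_tower_append[OF G subset_trans[OF wsL c]])
    then have "P (ws @ [y])" using y wsL by (simp add: P_def)
    then show False using ws(2) by fastforce
  qed
  then have "adj G (set ws) = L" using adj_least[OF L GL wsL] by blast
  then show ?thesis using wsL wsi bd by blast
qed

text \<open>
  Irredundancy of a set, as in the definition of an \<open>r\<close>-base, does not depend on an
  order; any enumeration gives a strict tower.
\<close>

lemma strict_tower_of_irredundant:
  "subfield P R \<Longrightarrow> set xs \<subseteq> carrier R \<Longrightarrow> distinct xs \<Longrightarrow> (\<And>x. x \<in> set xs \<Longrightarrow> x \<notin> adj P (set xs - {x})) \<Longrightarrow> strict_tower P xs"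
proof (induction xs arbitrary: P)
  case (Cons x xs)
  note Pc = subfieldE(3)[OF Cons.prems(1)]
  have x: "x \<in> carrier R" and xs: "set xs \<subseteq> carrier R" using Cons.prems(2) by auto
  have "x \<notin> P" using Cons.prems(4)[of x] adj_base[of P "set (x # xs) - {x}"] by auto
  moreover have "strict_tower (adj P {x}) xs"
  proof (rule Cons.IH)
    show "subfield (adj P {x}) R" using Pc x by (intro adj_subfield) auto
    show "y \<notin> adj (adj P {x}) (set xs - {y})" if y: "y \<in> set xs" for y
    proof -
      have "adj (adj P {x}) (set xs - {y}) = adj P (insert x (set xs - {y}))"
        using adj_insert[OF Pc x, of "set xs - {y}"] xs by auto
      also have "insert x (set xs - {y}) = set (x # xs) - {y}" using y Cons.prems(3) by auto
      finally show ?thesis using Cons.prems(4)[of y] y by simp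
    qed
  qed (use xs Cons.prems in auto)
  ultimately show ?case by simp
qed simp

section \<open>Descending chains of intermediate fields\<close>

lemma intermediate_field_iff:
  "intermediate_field R L k m \<longleftrightarrow> subfield m R \<and> k \<subseteq> m \<and> m \<subseteq> L"
  by (simp add: intermediate_field_def)

text \<open>
  The condition (i) on intermediate fields between \<open>k\<close> and the whole field.
\<close>

definition dcc :: "'a set \<Rightarrow> bool" where
  "dcc k \<longleftrightarrow> (\<forall>F :: nat \<Rightarrow> 'a set. (\<forall>n. intermediate_field R (carrier R) k (F n)) \<and> (\<forall>n. F (Suc n) \<subseteq> F n)
    \<longrightarrow> (\<exists>N. \<forall>n\<ge>N. F n = F N))"

lemma dcc_mono: "dcc k \<Longrightarrow> k \<subseteq> m \<Longrightarrow> dcc m"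
proof -
  assume d: "dcc k" and km: "k \<subseteq> m"
  show "dcc m" unfolding dcc_def
  proof (intro allI impI)
    fix F :: "nat \<Rightarrow> 'a set"
    assume "(\<forall>n. intermediate_field R (carrier R) m (F n)) \<and> (\<forall>n. F (Suc n) \<subseteq> F n)"
    then have "(\<forall>n. intermediate_field R (carrier R) k (F n)) \<and> (\<forall>n. F (Suc n) \<subseteq> F n)"
      using km by (auto simp: intermediate_field_iff)
    then show "\<exists>N. \<forall>n\<ge>N. F n = F N" by (rule mp[OF spec[OF d[unfolded dcc_def]]])
  qed
qed

lemma dcc_minimal:
  assumes dcc: "dcc k" and M0: "intermediate_field R (carrier R) k M0" "P M0"
  shows "\<exists>M. intermediate_field R (carrier R) k M \<and> P M \<and>
    (\<forall>M'. intermediate_field R (carrier R) k M' \<and> P M' \<and> M' \<subseteq> M \<longrightarrow> M' = M)"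
proof (rule ccontr)
  assume neg: "\<not> ?thesis"
  let ?Q = "\<lambda>M. intermediate_field R (carrier R) k M \<and> P M"
  have "\<exists>F. \<forall>n. ?Q (F n) \<and> F (Suc n) \<subset> F n"
  proof (rule dependent_nat_choice)
    show "\<exists>M. ?Q M" using M0 by blast
    fix M and n :: nat assume M: "?Q M"
    show "\<exists>M'. ?Q M' \<and> M' \<subset> M"
    proof (rule ccontr)
      assume "\<not> (\<exists>M'. ?Q M' \<and> M' \<subset> M)"
      then have "\<forall>M'. ?Q M' \<and> M' \<subseteq> M \<longrightarrow> M' = M" by (simp add: psubset_eq)
      then have "\<exists>M. intermediate_field R (carrier R) k M \<and> P M \<and>
          (\<forall>M'. intermediate_field R (carrier R) k M' \<and> P M' \<and> M' \<subseteq> M \<longrightarrow> M' = M)"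
        using M by (intro exI[of _ M] conjI) (simp_all add: conj_assoc)
      then show False by (rule notE[OF neg])
    qed
  qed
  then obtain F where "\<forall>n. ?Q (F n) \<and> F (Suc n) \<subset> F n" by (elim exE)
  then have F: "?Q (F n)" "F (Suc n) \<subset> F n" for n by simp_all
  have "(\<forall>n. intermediate_field R (carrier R) k (F n)) \<and> (\<forall>n. F (Suc n) \<subseteq> F n)"
    using F by (simp add: psubset_imp_subset)
  from mp[OF spec[OF dcc[unfolded dcc_def]] this] obtain N where "\<forall>n\<ge>N. F n = F N" by (elim exE)
  then have "F (Suc N) = F N" by (meson le_SucI le_refl)
  then show False using F(2)[of N] by blast
qed

end

section \<open>The Frobenius endomorphism\<close>

locale char_p_field = field R for R (structure) +
  fixes p :: nat
  assumes prime_p: "prime p" and char_p: "[p] \<cdot> \<one> = \<zero>"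
begin

definition frob :: "nat \<Rightarrow> 'a \<Rightarrow> 'a" where "frob n x = x [^] (p ^ n)"

lemma frob_power_eq: "frob_power R p n L = frob n ` L"
  by (simp add: frob_power_def frob_def)

lemma frob_closed [simp, intro]: "x \<in> carrier R \<Longrightarrow> frob n x \<in> carrier R"
  by (simp add: frob_def)

lemma p_gt_1: "1 < p" and p_pos: "0 < p"
  using prime_p prime_gt_1_nat prime_gt_0_nat by blast+

lemma frob_0 [simp]: "x \<in> carrier R \<Longrightarrow> frob 0 x = x"
  by (simp add: frob_def)

lemma frob_add: "x \<in> carrier R \<Longrightarrow> frob m (frob n x) = frob (m + n) x"
  by (simp add: frob_def nat_pow_pow power_add mult.commute)

lemma frob_1: "x \<in> carrier R \<Longrightarrow> frob (Suc 0) x = x [^] p"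
  by (simp add: frob_def)

lemma frob_mult: "x \<in> carrier R \<Longrightarrow> y \<in> carrier R \<Longrightarrow> frob n (x \<otimes> y) = frob n x \<otimes> frob n y"
  by (simp add: frob_def nat_pow_distrib)

lemma frob_plus: "x \<in> carrier R \<Longrightarrow> y \<in> carrier R \<Longrightarrow> frob n (x \<oplus> y) = frob n x \<oplus> frob n y"
proof (induction n)
  case (Suc n)
  have *: "frob (Suc n) z = (frob n z) [^] p" if "z \<in> carrier R" for z
    using that by (simp add: frob_def nat_pow_pow mult.commute)
  show ?case using Suc by (simp add: * freshman_dream[OF prime_p char_p])
qed simp

lemma frob_hom: "ring_hom_ring R R (frob n)"
proof (rule ring_hom_ringI2[OF ring_axioms ring_axioms])
  show "frob n \<in> ring_hom R R"
    by (rule ring_hom_memI) (auto simp: frob_mult frob_plus, simp add: frob_def)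
qed

lemma frob_zero [simp]: "frob n \<zero> = \<zero>" and frob_one [simp]: "frob n \<one> = \<one>"
  using p_pos by (auto simp: frob_def nat_pow_zero)

lemma frob_minus: "x \<in> carrier R \<Longrightarrow> frob n (\<ominus> x) = \<ominus> (frob n x)"
  using ring_hom_cring.hom_a_inv[OF ring_hom_cring.intro[OF is_cring is_cring]] frob_hom
  by (simp add: ring_hom_cring_axioms.intro ring_hom_ring.homh)

lemma frob_eq_zero: "x \<in> carrier R \<Longrightarrow> frob n x = \<zero> \<Longrightarrow> x = \<zero>"
proof (rule ccontr)
  assume x: "x \<in> carrier R" "frob n x = \<zero>" "x \<noteq> \<zero>"
  have "x [^] (m::nat) \<noteq> \<zero>" for m by (induction m) (use x integral in auto)
  then show False using x by (simp add: frob_def)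
qed

lemma frob_inj: "inj_on (frob n) (carrier R)"
proof (rule inj_onI)
  fix x y assume xy: "x \<in> carrier R" "y \<in> carrier R" "frob n x = frob n y"
  have "frob n (x \<oplus> \<ominus> y) = \<zero>" using xy by (simp add: frob_plus frob_minus r_neg)
  then have "x \<oplus> \<ominus> y = \<zero>" using frob_eq_zero[of "x \<oplus> \<ominus> y" n] xy by simp
  then show "x = y" using xy by (metis minus_eq r_right_minus_eq)
qed

lemma frob_subfield: "subfield F R \<Longrightarrow> x \<in> F \<Longrightarrow> frob n x \<in> F"
proof -
  assume F: "subfield F R" and x: "x \<in> F"
  have "x [^] (m::nat) \<in> F" for m
    by (induction m) (use subringE(3,6)[OF subfieldE(1)[OF F]] x in auto)
  then show ?thesis by (simp add: frob_def)
qed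

lemma subfield_frob_image: "subfield F R \<Longrightarrow> subfield (frob n ` F) R"
  using ring_hom_ring.img_is_subfield(2)[OF frob_hom] by simp

lemma subfield_frob_vimage:
  assumes "subfield L R" "subfield F R"
  shows "subfield {x \<in> L. frob n x \<in> F} R"
proof (rule subfieldI_closed)
  have c: "x \<in> carrier R" if "x \<in> L" for x using that assms(1) subfield_carrier by blast
  show "{x \<in> L. frob n x \<in> F} \<subseteq> carrier R" using c by auto
  show "\<one> \<in> {x \<in> L. frob n x \<in> F}" using assms subfield_props(2) by auto
  show "\<ominus> x \<in> {x \<in> L. frob n x \<in> F}" if "x \<in> {x \<in> L. frob n x \<in> F}" for x
    using that assms subfield_props(4) c by (auto simp: frob_minus)
  show "x \<oplus> y \<in> {x \<in> L. frob n x \<in> F}" if "x \<in> {x \<in> L. frob n x \<in> F}" "y \<in> {x \<in> L. frob n x \<in> F}" for x y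
    using that assms subfield_props(5) c by (auto simp: frob_plus)
  show "x \<otimes> y \<in> {x \<in> L. frob n x \<in> F}" if "x \<in> {x \<in> L. frob n x \<in> F}" "y \<in> {x \<in> L. frob n x \<in> F}" for x y
    using that assms subfield_props(6) c by (auto simp: frob_mult)
  show "inv x \<in> {x \<in> L. frob n x \<in> F}" if "x \<in> {x \<in> L. frob n x \<in> F}" "x \<noteq> \<zero>" for x
  proof -
    have x: "x \<in> Units R" "x \<in> carrier R" using that c field_Units by auto
    have "frob n x \<noteq> \<zero>" using x that frob_eq_zero by auto
    moreover have "inv (frob n x) = frob n (inv x)"
      using x by (intro comm_inv_char) (auto simp: frob_mult[symmetric])
    moreover have "inv (frob n x) \<in> F" "inv x \<in> L"
      using calculation(1) that assms by (auto intro: subfield_props(7))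
    ultimately show ?thesis by simp
  qed
qed

lemma frob_level_mono: "subfield k R \<Longrightarrow> x \<in> carrier R \<Longrightarrow> frob n x \<in> k \<Longrightarrow> n \<le> m \<Longrightarrow> frob m x \<in> k"
  using frob_subfield[of k "frob n x" "m - n"] by (simp add: frob_add)

lemma frob_adj_mem: "F \<subseteq> carrier R \<Longrightarrow> S \<subseteq> carrier R \<Longrightarrow> y \<in> adj F S \<Longrightarrow> frob n y \<in> adj (frob n ` F) (frob n ` S)"
proof -
  assume c: "F \<subseteq> carrier R" "S \<subseteq> carrier R" and y: "y \<in> adj F S"
  have im: "frob n ` F \<subseteq> carrier R" "frob n ` S \<subseteq> carrier R" using c by auto
  have "adj F S \<subseteq> {y \<in> carrier R. frob n y \<in> adj (frob n ` F) (frob n ` S)}"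
    using c adj_base[of "frob n ` F" "frob n ` S"] adj_gens[of "frob n ` S" "frob n ` F"]
    by (intro adj_least subfield_frob_vimage adj_subfield carrier_is_subfield im) auto
  then show ?thesis using y by auto
qed

text \<open>
  Only the generators have to be raised to the power: \<open>k(k(S)^p) = k(S^p)\<close>.
\<close>

lemma adj_frob_adj:
  assumes F: "subfield F R" and S: "S \<subseteq> carrier R"
  shows "adj F (frob n ` adj F S) = adj F (frob n ` S)"
proof (rule antisym)
  have Fc: "F \<subseteq> carrier R" using F subfieldE(3) by blast
  have imF: "frob n ` F \<subseteq> F" using frob_subfield[OF F] by auto
  have imS: "frob n ` S \<subseteq> carrier R" using S by auto
  have "frob n ` adj F S \<subseteq> adj (frob n ` F) (frob n ` S)" using frob_adj_mem[OF Fc S] by auto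
  also have "\<dots> \<subseteq> adj F (frob n ` S)" by (rule adj_mono[OF imF _ Fc imS]) auto
  finally show "adj F (frob n ` adj F S) \<subseteq> adj F (frob n ` S)"
    using adj_base by (intro adj_least adj_subfield Fc imS)
  show "adj F (frob n ` S) \<subseteq> adj F (frob n ` adj F S)"
    using adj_carrier[OF Fc S] by (intro adj_mono Fc image_mono adj_gens) auto
qed

lemma adj_frob_subset: "subfield E R \<Longrightarrow> F \<subseteq> E \<Longrightarrow> adj F (frob n ` E) \<subseteq> E"
  using frob_subfield by (intro adj_least) auto

text \<open>
  If \<open>L\<close> is generated over \<open>E\<close> by its \<open>p\<close>-th powers, it
  is generated by arbitrarily high powers; when the exponent is bounded these lie in
  \<open>E\<close>, so the lemma acts as a Nakayama lemma for generators modulo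
  \<open>p\<close>-th powers.
\<close>

lemma frobenius_nakayama:
  assumes E: "subfield E R" and L: "subfield L R" and EL: "E \<subseteq> L" and eq: "adj E (frob 1 ` L) = L"
  shows "adj E (frob n ` L) = L"
proof (induction n)
  case 0
  have "frob 0 ` L = L" using subfieldE(3)[OF L] by force
  then show ?case using adj_least[OF L EL, of L] adj_gens[of L E] by auto
next
  case (Suc n)
  have c: "L \<subseteq> carrier R" "E \<subseteq> carrier R" using subfieldE(3) L E by auto
  let ?D = "adj E (frob (Suc n) ` L)"
  have D: "subfield ?D R" using c by (intro adj_subfield) auto
  have "adj E (frob 1 ` L) \<subseteq> {y \<in> carrier R. frob n y \<in> ?D}"
  proof (rule adj_least)
    show "subfield {y \<in> carrier R. frob n y \<in> ?D} R" by (rule subfield_frob_vimage[OF carrier_is_subfield D])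
    show "E \<subseteq> {y \<in> carrier R. frob n y \<in> ?D}"
      using c frob_subfield[OF E] adj_base[of E "frob (Suc n) ` L"] by auto
    show "frob 1 ` L \<subseteq> {y \<in> carrier R. frob n y \<in> ?D}"
      using c adj_gens[of "frob (Suc n) ` L" E] by (auto simp: frob_add[OF subsetD[OF c(1)]])
  qed
  then have "frob n ` L \<subseteq> ?D" using eq by auto
  then have "L \<subseteq> ?D" using Suc adj_least[OF D adj_base] by blast
  moreover have "?D \<subseteq> L" by (rule adj_frob_subset[OF L EL])
  ultimately show ?case by blast
qed

text \<open>
  In a tower \<open>T\<close> of this kind raising to the \<open>p\<close>-th power and
  adjoining the base moves down exactly one step.
\<close>

lemma tower_descend:
  assumes T: "\<And>j. subfield (T j) R" and inc: "\<And>j. T j \<subseteq> T (Suc j)"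
    and step: "\<And>j. adj (T 0) (frob 1 ` T (Suc j)) = T j"
  shows "adj (T 0) (frob i ` T (i + n)) = T n"
proof (induction i)
  case 0
  have e: "frob 0 ` T n = T n" using subfieldE(3)[OF T] by force
  have "T 0 \<subseteq> T n" using lift_Suc_mono_le[of T, OF inc] by simp
  then show ?case using adj_least[OF T[of n] _ subset_refl, of "T 0"] adj_gens[of "T n" "T 0"] e by auto
next
  case (Suc i)
  let ?S = "frob 1 ` T (Suc (i + n))"
  have S: "?S \<subseteq> carrier R" using subfieldE(3)[OF T] by blast
  have "frob (Suc i) ` T (Suc i + n) = frob i ` ?S"
    using subfieldE(3)[OF T, of "Suc (i + n)"] by (auto simp: image_image frob_add subset_iff intro!: image_cong)
  then have "adj (T 0) (frob (Suc i) ` T (Suc i + n)) = adj (T 0) (frob i ` adj (T 0) ?S)"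
    using adj_frob_adj[OF T S] by simp
  also have "\<dots> = T n" using step Suc by simp
  finally show ?case .
qed

lemma frob_dimension:
  assumes "subfield F R" "dimension n F E" "E \<subseteq> carrier R"
  shows "dimension n (frob m ` F) (frob m ` E)"
  using ring_hom_ring.inj_hom_dimension[OF frob_hom assms(1) one_not_zero _ assms(2)]
    inj_on_subset[OF frob_inj assms(3)] by blast

lemma frob_dim:
  assumes "subfield F R" "finite_dimension F E" "E \<subseteq> carrier R"
  shows "finite_dimension (frob m ` F) (frob m ` E)" "dim (frob m ` F) (frob m ` E) = dim F E"
proof -
  have d: "dimension (dim F E) (frob m ` F) (frob m ` E)"
    using frob_dimension[OF assms(1) dim_dimension[OF assms(1,2)] assms(3)] .
  show "finite_dimension (frob m ` F) (frob m ` E)" by (rule finite_dimensionI[OF d])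
  show "dim (frob m ` F) (frob m ` E) = dim F E" by (rule dim_eqI[OF subfield_frob_image[OF assms(1)] d])
qed

section \<open>Adjoining \<open>p\<close>-th roots\<close>

lemma add_pow_subfield: "subfield F R \<Longrightarrow> y \<in> F \<Longrightarrow> [(n::nat)] \<cdot> y \<in> F"
  by (induction n) (auto dest: subfield_props)

text \<open>
  By the binomial identity the polynomial \<open>(X - x)^p\<close> equals
  \<open>X^p - x^p\<close>, with coefficients in \<open>F\<close>.
\<close>

lemma lin_pow_p_closed:
  assumes F: "subfield F R" and x: "x \<in> carrier R" and xp: "x [^] p \<in> F"
  shows "lin_pow x p \<in> carrier (F[X])"
proof -
  interpret UP: cring "poly_ring R" using univ_poly_is_cring[OF carrier_is_subring] .
  interpret UF: cring "F[X]" using univ_poly_is_cring[OF subfieldE(1)[OF F]] .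
  interpret C: ring_hom_ring R "poly_ring R" poly_of_const
    using canonical_embedding_ring_hom[OF carrier_is_subring] by simp
  have X: "X \<in> carrier (poly_ring R)" using var_closed(1)[OF carrier_is_subring] .
  have ch: "[(m::nat)] \<cdot>\<^bsub>poly_ring R\<^esub> \<one>\<^bsub>poly_ring R\<^esub> = poly_of_const ([m] \<cdot> \<one>)" for m
    by (induction m) auto
  have pw: "poly_of_const y [^]\<^bsub>poly_ring R\<^esub> (m::nat) = poly_of_const (y [^] m)" if "y \<in> carrier R" for y m
    using that by (induction m) auto
  have lin: "[\<one>, \<ominus> x] = X \<oplus>\<^bsub>poly_ring R\<^esub> poly_of_const (\<ominus> x)"
    using x by (simp add: univ_poly_add var_def poly_of_const_def)
  have nx: "(\<ominus> x) [^] p \<in> F"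
  proof -
    have "(\<ominus> x) [^] p = \<ominus> (x [^] p)" using frob_minus[OF x, of 1] x by (simp add: frob_1)
    then show ?thesis using subfield_props(4)[OF F xp] by simp
  qed
  have "lin_pow x p = X [^]\<^bsub>poly_ring R\<^esub> p \<oplus>\<^bsub>poly_ring R\<^esub> poly_of_const (\<ominus> x) [^]\<^bsub>poly_ring R\<^esub> p"
    unfolding lin using x X by (intro UP.freshman_dream prime_p) (auto simp: ch char_p)
  also have "\<dots> = X [^]\<^bsub>F[X]\<^esub> p \<oplus>\<^bsub>F[X]\<^esub> poly_of_const ((\<ominus> x) [^] p)"
    unfolding pw[OF a_inv_closed[OF x]] unitary_monom_eq_var_pow[OF carrier_is_subring, symmetric]
      unitary_monom_eq_var_pow[OF subfieldE(1)[OF F], symmetric] univ_poly_add ..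
  also have "\<dots> \<in> carrier (F[X])"
    using var_pow_closed[OF subfieldE(1)[OF F]] poly_of_const_over_subfield[OF F] nx
    by (intro UF.a_closed) auto
  finally show ?thesis .
qed

lemma eval_lin_pow: "x \<in> carrier R \<Longrightarrow> n > 0 \<Longrightarrow> eval (lin_pow x n) x = \<zero>"
proof -
  assume x: "x \<in> carrier R" and n: "n > 0"
  interpret E: ring_hom_ring "poly_ring R" R "\<lambda>q. eval q x"
    using eval_ring_hom[OF carrier_is_subring x] .
  have 1: "eval [\<one>, \<ominus> x] x = \<zero>" using x by (simp add: r_neg)
  obtain m where "n = Suc m" using n gr0_implies_Suc by blast
  then have "eval (lin_pow x n) x = eval [\<one>, \<ominus> x] x \<otimes> eval (lin_pow x m) x"
    unfolding lin_pow_Suc[OF x] using E.hom_mult[OF linear_in_poly_ring[OF x] lin_pow_closed[OF x, of m]]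
    by (simp only: lin_pow_Suc[OF x])
  also have "\<dots> = \<zero>" unfolding 1 using eval_in_carrier[OF lin_pow_set[OF x] x] by simp
  finally show ?thesis .
qed

text \<open>
  The minimal polynomial of \<open>x\<close> divides \<open>X^p - x^p = (X - x)^p\<close>, so it
  is a power \<open>(X - x)^j\<close>; an exponent strictly between \<open>0\<close> and
  \<open>p\<close> would put \<open>j x\<close>, hence \<open>x\<close>, into \<open>F\<close>.
\<close>

lemma Irr_pth_root:
  assumes F: "subfield F R" and x: "x \<in> carrier R" and xp: "x [^] p \<in> F"
  shows "(algebraic over F) x" and "degree (Irr F x) \<le> p" and "x \<notin> F \<Longrightarrow> degree (Irr F x) = p"
proof -
  note q = lin_pow_p_closed[OF F x xp]
  show alg: "(algebraic over F) x"
    using algebraicI[OF q lin_pow_degree(1)[OF x] eval_lin_pow[OF x p_pos]] by (simp add: over_def)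
  note I = IrrE[OF F x alg]
  have IR: "Irr F x \<in> carrier (poly_ring R)"
    using I(1) subfieldE(3)[OF F] unfolding univ_poly_carrier[symmetric] polynomial_def by blast
  have dvd: "Irr F x pdivides lin_pow x p"
    using Irr_minimal[OF F x alg q eval_lin_pow[OF x p_pos]] .
  have eq: "Irr F x = lin_pow x (degree (Irr F x))" by (rule pdivides_lin_pow[OF x IR I(3) dvd])
  show le: "degree (Irr F x) \<le> p"
    using pdivides_imp_degree_le[OF carrier_is_subring IR lin_pow_closed[OF x] lin_pow_degree(1)[OF x] dvd]
      lin_pow_degree(2)[OF x] by simp
  have "degree (Irr F x) > 0" using pirreducible_degree[OF F I(1,2)] by simp
  then obtain m where m: "degree (Irr F x) = Suc m" using gr0_implies_Suc by blast
  show "degree (Irr F x) = p" if xF: "x \<notin> F"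
  proof (rule ccontr)
    assume "degree (Irr F x) \<noteq> p"
    then have lt: "degree (Irr F x) < p" using le by simp
    let ?j = "degree (Irr F x)"
    have set: "set (Irr F x) \<subseteq> F" 
      using I(1) polynomial_incl univ_poly_carrier by blast
    \<comment> \<open>The coefficient below the leading one of \<open>(X - x)^j\<close> is \<open>- j x\<close>, and \<open>j\<close> is invertible modulo \<open>p\<close>.\<close>
    have "coeff (Irr F x) m \<in> F"
    proof -
      have "coeff (Irr F x) m \<in> set (Irr F x) \<union> {\<zero>}"
        unfolding coeff_img(3)[symmetric] by (rule rangeI)
      also have "\<dots> \<subseteq> F" using set subfield_props(3)[OF F] by simp
      finally show ?thesis .
    qed
    moreover have "coeff (lin_pow x ?j) m = [?j] \<cdot> (\<ominus> x)"
      by (rule mp[OF spec[OF conjunct2[OF conjunct2[OF lin_pow_coeffs[OF x]]]] m])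
    then have "coeff (Irr F x) m = [?j] \<cdot> (\<ominus> x)" unfolding eq[symmetric] .
    ultimately have jx: "[?j] \<cdot> (\<ominus> x) \<in> F" by simp
    have "\<exists>u v. j * u = p * v + 1" if j: "j < p" "j > 0" for j :: nat
    proof -
      have "\<not> p dvd j" using j by (auto dest: dvd_imp_le)
      then have "gcd p j = 1" using prime_imp_coprime[OF prime_p] by simp
      then show ?thesis using bezout_nat[of j p] j by (simp add: gcd.commute)
    qed
    from this[OF lt] have "\<exists>u v. ?j * u = p * v + 1" by (simp only: m zero_less_Suc)
    then obtain u v where uv: "?j * u = p * v + 1" by (elim exE)
    have nx: "\<ominus> x \<in> carrier R" using x by simp
    have "[p] \<cdot> (\<ominus> x) = \<zero>" using add_pow_ldistr[of \<one> "\<ominus> x" p] char_p nx by simp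
    then have "[(p * v)] \<cdot> (\<ominus> x) = \<zero>"
      using add.nat_pow_pow[OF nx, of v p] by simp
    then have "[(?j * u)] \<cdot> (\<ominus> x) = \<ominus> x"
      unfolding uv using add.nat_pow_mult[OF nx, of "p * v" 1] x by simp
    moreover have "[(?j * u)] \<cdot> (\<ominus> x) \<in> F"
      using add_pow_subfield[OF F jx, of u] unfolding add.nat_pow_pow[OF nx] .
    ultimately have "\<ominus> x \<in> F" by simp
    then show False using subfield_props(4)[OF F, of "\<ominus> x"] xF x by simp
  qed
qed

lemma dim_pth_root:
  assumes F: "subfield F R" and x: "x \<in> carrier R" and xp: "frob 1 x \<in> F"
  shows "finite_dimension F (adj F {x})" "dim F (adj F {x}) \<le> p" "x \<notin> F \<Longrightarrow> dim F (adj F {x}) = p"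
proof -
  have xp': "x [^] p \<in> F" using xp x by (simp add: frob_1)
  note I = Irr_pth_root[OF F x xp']
  have d: "dimension (degree (Irr F x)) F (adj F {x})"
    using dimension_simple_extension[OF F x I(1)] adj_eq_simple_extension[OF F x I(1)] by simp
  show "finite_dimension F (adj F {x})" by (rule finite_dimensionI[OF d])
  show "dim F (adj F {x}) \<le> p" "x \<notin> F \<Longrightarrow> dim F (adj F {x}) = p"
    using dim_eqI[OF F d] I(2,3) by simp_all
qed

lemma dim_adj_pth_roots:
  "subfield G R \<Longrightarrow> set ws \<subseteq> carrier R \<Longrightarrow> (\<And>w. w \<in> set ws \<Longrightarrow> frob 1 w \<in> G) \<Longrightarrow>
    finite_dimension G (adj G (set ws)) \<and> dim G (adj G (set ws)) \<le> p ^ length ws"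
proof (induction ws arbitrary: G)
  case Nil
  have "dimension 1 G G" using dimension_one[OF Nil(1)] .
  then show ?case using Nil finite_dimensionI dim_eqI[of G 1 G] by (auto simp: adj_empty)
next
  case (Cons w ws)
  have c: "G \<subseteq> carrier R" using subfieldE(3) Cons.prems by blast
  have w: "w \<in> carrier R" "frob 1 w \<in> G" using Cons.prems by auto
  have H: "subfield (adj G {w}) R" using c w by (intro adj_subfield) auto
  have "finite_dimension (adj G {w}) (adj (adj G {w}) (set ws)) \<and>
      dim (adj G {w}) (adj (adj G {w}) (set ws)) \<le> p ^ length ws"
    using Cons.prems adj_base[of G "{w}"] by (intro Cons.IH H) auto
  moreover note d = dim_pth_root(1,2)[OF Cons.prems(1) w]
  moreover have "adj (adj G {w}) (set ws) = adj G (set (w # ws))"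
    using adj_insert[OF c w(1), of "set ws"] Cons.prems by simp
  ultimately show ?case
    using deg_tower[OF Cons.prems(1) H d(1)] by (simp add: mult_le_mono)
qed

text \<open>
  The exchange property is what makes relative \<open>p\<close>-independence a matroid: since
  every nontrivial simple step has degree exactly \<open>p\<close>, there is no room between
  \<open>F\<close> and \<open>F(x)\<close>.
\<close>

lemma exchange:
  assumes F: "subfield F R" and x: "x \<in> carrier R" "frob 1 x \<in> F" and b: "b \<in> carrier R" "frob 1 b \<in> F"
    and bx: "b \<in> adj F {x}" "b \<notin> F"
  shows "x \<in> adj F {b}"
proof (rule ccontr)
  assume xG: "x \<notin> adj F {b}"
  have c: "F \<subseteq> carrier R" using subfieldE(3)[OF F] .
  have G: "subfield (adj F {b}) R" using c b by (intro adj_subfield) auto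
  have X: "subfield (adj F {x}) R" using c x by (intro adj_subfield) auto
  have "adj (adj F {b}) {x} = adj (adj F {x}) {b}"
    using c x b by (simp add: adj_adj insert_commute)
  also have "\<dots> = adj F {x}" using bx by (intro adj_absorb X) auto
  finally have eq: "adj (adj F {b}) {x} = adj F {x}" .
  have xG': "frob 1 x \<in> adj F {b}" using x adj_base[of F "{b}"] by auto
  note d1 = dim_pth_root[OF F b] and d2 = dim_pth_root[OF G x(1) xG']
  \<comment> \<open>The degree of \<open>F(x)\<close> computed through \<open>F(b)\<close> would be \<open>p * p\<close>.\<close>
  have "dim F (adj F {x}) = p * p"
    using deg_tower(2)[OF F G d1(1) d2(1)] d1(3)[OF bx(2)] d2(3)[OF xG] eq by simp
  moreover have "dim F (adj F {x}) \<le> p" by (rule dim_pth_root(2)[OF F x])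
  ultimately show False using p_gt_1 by simp
qed

text \<open>
  Zorn gives a maximal irredundant set; by exchange an element outside the field that it
  generates could be added to it.
\<close>

lemma r_base_exists:
  assumes L: "subfield L R" and kL: "k \<subseteq> L"
  shows "\<exists>B. r_base R p L k B"
proof -
  let ?P = "adj k (frob 1 ` L)"
  have c: "L \<subseteq> carrier R" "k \<subseteq> carrier R" using subfieldE(3)[OF L] kL by auto
  have fc: "frob 1 ` L \<subseteq> carrier R" using c by auto
  have P: "subfield ?P R" by (rule adj_subfield[OF c(2) fc])
  note Pc = subfieldE(3)[OF P]
  have PL: "?P \<subseteq> L" by (rule adj_frob_subset[OF L kL])
  define I where "I = {B. B \<subseteq> L \<and> (\<forall>x\<in>B. x \<notin> adj ?P (B - {x}))}"
  have "\<exists>M\<in>I. \<forall>Z\<in>I. M \<subseteq> Z \<longrightarrow> Z = M"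
  proof (rule subset_Zorn_nonempty)
    show "I \<noteq> {}" by (auto simp: I_def)
    fix \<C> assume C: "\<C> \<noteq> {}" "subset.chain I \<C>"
    have CI: "\<C> \<subseteq> I" using C by (simp add: subset_chain_def)
    have CL: "B \<subseteq> L" and Ci: "\<And>x. x \<in> B \<Longrightarrow> x \<notin> adj ?P (B - {x})" if "B \<in> \<C>" for B
      using CI that unfolding I_def by blast+
    have "x \<notin> adj ?P (\<Union>\<C> - {x})" if x: "x \<in> \<Union>\<C>" for x
    proof
      assume xa: "x \<in> adj ?P (\<Union>\<C> - {x})"
      have cc: "\<Union>\<C> - {x} \<subseteq> carrier R" using CL c(1) by blast
      from adj_finite_support[OF Pc cc xa]
      obtain T where T: "finite T" "T \<subseteq> \<Union>\<C> - {x}" "x \<in> adj ?P T" by (elim exE conjE)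
      have "finite (insert x T)" "insert x T \<subseteq> \<Union>\<C>" using T x by auto
      from finite_subset_Union_chain[OF this C(1,2)]
      obtain B where B: "B \<in> \<C>" "insert x T \<subseteq> B" .
      have "T \<subseteq> B - {x}" "B - {x} \<subseteq> carrier R" using T(2) B(2) CL[OF B(1)] c(1) by blast+
      then have "x \<in> adj ?P (B - {x})" using T(3) adj_mono[OF subset_refl, of T "B - {x}" ?P] Pc by blast
      then show False using B(2) Ci[OF B(1), of x] by blast
    qed
    then show "\<Union>\<C> \<in> I" unfolding I_def using CL by blast
  qed
  then obtain M where M: "M \<in> I" "\<And>Z. Z \<in> I \<Longrightarrow> M \<subseteq> Z \<Longrightarrow> Z = M" by blast
  have subM: "M \<subseteq> L" and Mi: "\<And>x. x \<in> M \<Longrightarrow> x \<notin> adj ?P (M - {x})" using M(1) by (auto simp: I_def)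
  have Mc: "M \<subseteq> carrier R" using subM c by auto
  have fL: "frob 1 z \<in> ?P" if "z \<in> L" for z using that adj_gens[of "frob 1 ` L" k] by auto
  have "y \<in> adj ?P M" if y: "y \<in> L" for y
  proof (rule ccontr)
    assume ny: "y \<notin> adj ?P M"
    then have yM: "y \<notin> M" using adj_gens[of M ?P] by auto
    have yc: "y \<in> carrier R" using y c by auto
    have "x \<notin> adj ?P (insert y M - {x})" if x: "x \<in> insert y M" for x
    proof (cases "x = y")
      case True
      then show ?thesis using ny yM by simp
    next
      case False
      then have xM: "x \<in> M" and xc: "x \<in> carrier R" using x Mc by auto
      let ?F = "adj ?P (M - {x})"
      have Mxc: "M - {x} \<subseteq> carrier R" using Mc by auto
      have F: "subfield ?F R" by (rule adj_subfield[OF Pc Mxc])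
      have i: "insert y M - {x} = (M - {x}) \<union> {y}" "M = (M - {x}) \<union> {x}" using False xM by auto
      show ?thesis
      proof
        assume "x \<in> adj ?P (insert y M - {x})"
        then have xF: "x \<in> adj ?F {y}" unfolding i(1) using adj_adj[OF Pc Mxc, of "{y}"] yc by simp
        have fF: "frob 1 y \<in> ?F" "frob 1 x \<in> ?F"
          using adj_base[of ?P "M - {x}"] fL[OF y] fL[OF subsetD[OF subM xM]] by blast+
        have "y \<in> adj ?F {x}" by (rule exchange[OF F yc fF(1) xc fF(2) xF Mi[OF xM]])
        also have "adj ?F {x} = adj ?P M" using adj_adj[OF Pc Mxc, of "{x}"] xc i(2) by simp
        finally show False using ny by simp
      qed
    qed
    then have "insert y M \<in> I" unfolding I_def using y subM by blast
    then show False using M(2)[of "insert y M"] yM by auto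
  qed
  then have "adj ?P M = L" using adj_least[OF L PL subM] by blast
  then show ?thesis unfolding r_base_def frob_power_eq using subM Mi by auto
qed

section \<open>Purely inseparable base fields\<close>

text \<open>
  Pure inseparability of the whole field over \<open>F\<close>. All base fields that occur lie
  between the given \<open>k\<close> and the whole field, and inherit this property.
\<close>

definition pinsep :: "'a set \<Rightarrow> bool" where
  "pinsep F \<longleftrightarrow> subfield F R \<and> (\<forall>x\<in>carrier R. \<exists>n. frob n x \<in> F)"

lemma pinsep_subfield: "pinsep F \<Longrightarrow> subfield F R"
  by (simp add: pinsep_def)

lemma pinsep_carrier: "pinsep F \<Longrightarrow> F \<subseteq> carrier R"
  using pinsep_subfield subfieldE(3) by blast

lemma pinsep_mono: "pinsep F \<Longrightarrow> subfield E R \<Longrightarrow> F \<subseteq> E \<Longrightarrow> pinsep E"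
  unfolding pinsep_def by blast

lemma pinsep_adj: "pinsep F \<Longrightarrow> S \<subseteq> carrier R \<Longrightarrow> pinsep (adj F S)"
  by (rule pinsep_mono[OF _ adj_subfield[OF pinsep_carrier] adj_base])

text \<open>
  Adjoin \<open>x^p\<close> first and then its \<open>p\<close>-th root \<open>x\<close>.
\<close>

lemma finite_adj_single:
  assumes F: "subfield F R" and x: "x \<in> carrier R" and "frob n x \<in> F"
  shows "finite_dimension F (adj F {x})"
  using x assms(3)
proof (induction n arbitrary: x)
  case 0
  then show ?case using dim_pth_root(1)[OF F, of x] frob_subfield[OF F, of x 1] by simp
next
  case (Suc n)
  let ?y = "frob 1 x"
  note c = subfieldE(3)[OF F]
  have "frob n ?y \<in> F" using Suc.prems by (simp add: frob_add)
  then have fin: "finite_dimension F (adj F {?y})" using Suc by simp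
  have G: "subfield (adj F {?y}) R" using c Suc.prems by (intro adj_subfield) auto
  have "finite_dimension (adj F {?y}) (adj (adj F {?y}) {x})"
    using adj_gens[of "{?y}" F] Suc.prems by (intro dim_pth_root(1) G) auto
  then have "finite_dimension F (adj (adj F {?y}) {x})" by (rule deg_tower(1)[OF F G fin])
  moreover have "adj (adj F {?y}) {x} = adj F {x}"
  proof -
    have H: "subfield (adj F {x}) R" using c Suc.prems by (intro adj_subfield) auto
    have "?y \<in> adj F {x}" using frob_subfield[OF H] adj_gens[of "{x}" F] by auto
    then have "adj (adj F {x}) {?y} = adj F {x}" by (intro adj_absorb H) auto
    moreover have "adj (adj F {x}) {?y} = adj (adj F {?y}) {x}"
      using c Suc.prems by (simp add: adj_adj insert_commute)
    ultimately show ?thesis by simp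
  qed
  ultimately show ?case by simp
qed

lemma finite_adj:
  assumes "finite S" "pinsep F" "S \<subseteq> carrier R"
  shows "finite_dimension F (adj F S)"
  using assms
proof (induction S arbitrary: F rule: finite_induct)
  case empty
  have "adj F {} = F" using adj_absorb[of F "{}"] pinsep_subfield empty by blast
  then show ?case
    using finite_dimensionI[OF dimension_one[OF pinsep_subfield[OF empty(1)]]] by simp
next
  case (insert x S)
  then have x: "x \<in> carrier R" by simp
  note F = pinsep_subfield[OF insert.prems(1)]
  have G: "pinsep (adj F {x})" using insert x by (intro pinsep_adj) auto
  obtain n where "frob n x \<in> F" using insert.prems x unfolding pinsep_def by blast
  then have "finite_dimension F (adj F {x})" by (rule finite_adj_single[OF F x])
  moreover have "finite_dimension (adj F {x}) (adj (adj F {x}) S)" using insert G by auto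
  ultimately have "finite_dimension F (adj (adj F {x}) S)"
    by (rule deg_tower(1)[OF F pinsep_subfield[OF G]])
  then show ?case using insert.prems adj_insert[OF pinsep_carrier, of F x S] by simp
qed

lemma bounded_exponent:
  assumes F: "pinsep F" and S: "finite S" "S \<subseteq> carrier R"
  shows "\<exists>n. frob n ` adj F S \<subseteq> F"
proof -
  note Ff = pinsep_subfield[OF F] and Fc = pinsep_carrier[OF F]
  have "\<exists>n. \<forall>s\<in>S. frob n s \<in> F" using S
  proof (induction S rule: finite_induct)
    case (insert x S)
    then obtain n where n: "\<forall>s\<in>S. frob n s \<in> F" by auto
    obtain m where m: "frob m x \<in> F" using F insert.prems unfolding pinsep_def by blast
    have "frob (n + m) s \<in> F" if "s \<in> insert x S" for s
    proof (cases "s = x")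
      case True
      then show ?thesis using frob_subfield[OF Ff m, of n] insert.prems by (simp add: frob_add)
    next
      case False
      then have "frob n s \<in> F" "s \<in> carrier R" using n that insert.prems by auto
      then show ?thesis using frob_subfield[OF Ff, of "frob n s" m] by (simp add: frob_add add.commute)
    qed
    then show ?case by blast
  qed simp
  then obtain n where n: "\<forall>s\<in>S. frob n s \<in> F" by blast
  have "adj F S \<subseteq> {x \<in> carrier R. frob n x \<in> F}"
    using Fc S n frob_subfield[OF Ff]
    by (intro adj_least subfield_frob_vimage carrier_is_subfield Ff) auto
  then show ?thesis by blast
qed

text \<open>
  A basis of \<open>A\<close> over \<open>B\<close> spans the compositum with a larger base
  \<open>D\<close>: its span is closed under products, and pure inseparability makes this ring a
  field.
\<close>

lemma Span_compositum:
  assumes A: "subfield A R" and B: "subfield B R" and Us: "set Us \<subseteq> carrier R" "Span B Us = A"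
    and D: "pinsep D" and BD: "B \<subseteq> D"
  shows "adj D A = Span D Us"
proof (rule antisym)
  let ?V = "Span D Us"
  note Df = pinsep_subfield[OF D] and Dc = pinsep_carrier[OF D]
  note V = Span_subgroup_props[OF Df Us(1)] Span_smult_closed[OF Df Us(1)]
  have UA: "set Us \<subseteq> A" using Span_base_incl[OF B Us(1)] Us(2) by simp
  have AV: "A \<subseteq> ?V" using mono_Span_field[OF B Df BD Us(1)] Us(2) by simp
  have one: "\<one> \<in> ?V" using AV subfield_props(2)[OF A] by auto
  have DV: "D \<subseteq> ?V" using V(5)[OF _ one] Dc by force
  have sub: "?V \<subseteq> {a \<in> carrier R. a \<otimes> w \<in> ?V}" if w: "w \<in> carrier R" "\<And>u. u \<in> set Us \<Longrightarrow> u \<otimes> w \<in> ?V" for w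
  proof (rule subalgebra_Span_incl[OF Df])
    have "subgroup {a \<in> carrier R. a \<otimes> w \<in> ?V} (add_monoid R)"
      using V w(1) by (intro add.subgroupI) (auto simp: l_distr l_minus)
    then show "subalgebra D {a \<in> carrier R. a \<otimes> w \<in> ?V} R"
      using V(5) w(1) Dc by (intro subalgebra.intro subalgebra_axioms.intro) (auto simp: m_assoc)
    show "set Us \<subseteq> {a \<in> carrier R. a \<otimes> w \<in> ?V}" using w Us by auto
  qed
  have AV': "v \<otimes> a \<in> ?V" if "v \<in> ?V" "a \<in> A" for v a
    using sub[of a] that AV UA subfield_props(1,6)[OF A] by blast
  have mult: "v \<otimes> w \<in> ?V" if "v \<in> ?V" "w \<in> ?V" for v w
  proof -
    have "u \<otimes> w \<in> ?V" if "u \<in> set Us" for u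
    proof -
      have "u \<in> A" "u \<in> carrier R" "w \<in> carrier R" using UA that V(1) \<open>w \<in> ?V\<close> Us(1) by blast+
      then show ?thesis using AV'[OF \<open>w \<in> ?V\<close>, of u] m_comm[of u w] by metis
    qed
    then show ?thesis using sub[of w] that V(1) by blast
  qed
  have pow: "v [^] (n::nat) \<in> ?V" if "v \<in> ?V" for v n
    by (induction n) (use one mult that in auto)
  have "subfield ?V R"
  proof (rule subfieldI_closed)
    \<comment> \<open>A power \<open>v^(p^n)\<close> lies in \<open>D\<close>, so \<open>inv v\<close> is a power of \<open>v\<close> times an element of \<open>D\<close>.\<close>
    show "inv v \<in> ?V" if v: "v \<in> ?V" "v \<noteq> \<zero>" for v
    proof -
      have vc: "v \<in> carrier R" using v V(1) by blast
      obtain n where n: "frob n v \<in> D" using D vc unfolding pinsep_def by blast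
      have nz: "frob n v \<noteq> \<zero>" using v vc frob_eq_zero by blast
      obtain m where m: "p ^ n = Suc m" using p_pos by (metis gr0_implies_Suc zero_less_power)
      have i: "inv (frob n v) \<in> D" by (rule subfield_props(7)[OF Df n nz])
      have ic: "inv (frob n v) \<in> carrier R" using i Dc by blast
      have "v \<otimes> (inv (frob n v) \<otimes> v [^] m) = inv (frob n v) \<otimes> (v [^] m \<otimes> v)"
        using vc ic by (simp add: m_ac)
      also have "v [^] m \<otimes> v = frob n v" by (simp add: frob_def m)
      also have "inv (frob n v) \<otimes> frob n v = \<one>" using nz vc by (simp add: field_Units)
      finally have "v \<otimes> (inv (frob n v) \<otimes> v [^] m) = \<one>" .
      then have "inv v = inv (frob n v) \<otimes> v [^] m" using vc ic by (intro comm_inv_char) auto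
      then show ?thesis using V(5)[OF i pow[OF v(1)]] by simp
    qed
  qed (use V one mult in auto)
  then show "adj D A \<subseteq> ?V" by (rule adj_least[OF _ DV AV])
  have Ac: "A \<subseteq> carrier R" using subfieldE(3)[OF A] .
  show "?V \<subseteq> adj D A"
    using UA adj_gens[of A D] adj_base[of D A] Ac Dc
    by (intro subalgebra_Span_incl[OF Df] subfield_subalgebra adj_subfield) auto
qed

lemma compositum_dim:
  assumes A: "subfield A R" and B: "subfield B R" and BA: "B \<subseteq> A" and fin: "finite_dimension B A" and C: "pinsep C"
  shows "finite_dimension (adj C B) (adj C A)" "dim (adj C B) (adj C A) \<le> dim B A"
proof -
  obtain Us where Us: "set Us \<subseteq> carrier R" "Span B Us = A" "length Us = dim B A"
    using exists_base[OF B dim_dimension[OF B fin]] by blast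
  have Ac: "A \<subseteq> carrier R" and Bc: "B \<subseteq> carrier R" using subfieldE(3) A B by auto
  have D: "pinsep (adj C B)" by (rule pinsep_adj[OF C Bc])
  have "adj (adj C B) A = Span (adj C B) Us" by (rule Span_compositum[OF A B Us(1,2) D adj_gens])
  moreover have "adj (adj C B) A = adj C A"
    using adj_adj[OF pinsep_carrier[OF C] Bc Ac] BA by (simp add: Un_absorb1)
  ultimately have eq: "adj C A = Span (adj C B) Us" by simp
  show "finite_dimension (adj C B) (adj C A)" unfolding eq
    by (rule Span_finite_dimension[OF pinsep_subfield[OF D] Us(1)])
  show "dim (adj C B) (adj C A) \<le> dim B A" unfolding eq Us(3)[symmetric]
    by (rule dim_Span_le[OF pinsep_subfield[OF D] Us(1)])
qed

text \<open>
  The number of generators modulo \<open>p\<close>-th powers grows with the field. Writing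
  \<open>E' = F(E^p)\<close> and \<open>M' = F(M^p)\<close>, the degree of \<open>M\<close> over
  \<open>E'\<close> is computed through \<open>E\<close> and through \<open>M'\<close>;
  Frobenius bounds the degree of \<open>M'\<close> over \<open>E'\<close> by that of
  \<open>M\<close> over \<open>E\<close>.
\<close>

lemma dim_mod_pth_powers_mono:
  assumes F: "pinsep F" and E: "subfield E R" and M: "subfield M R" and FE: "F \<subseteq> E" and EM: "E \<subseteq> M"
    and fin: "finite_dimension F M"
  shows "dim (adj F (frob 1 ` E)) E \<le> dim (adj F (frob 1 ` M)) M"
proof -
  let ?E = "adj F (frob 1 ` E)" and ?M = "adj F (frob 1 ` M)"
  note Ff = pinsep_subfield[OF F] and Fc = pinsep_carrier[OF F]
  have c: "E \<subseteq> carrier R" "M \<subseteq> carrier R" using subfieldE(3) E M by auto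
  have fc: "frob 1 ` E \<subseteq> carrier R" "frob 1 ` M \<subseteq> carrier R" using c by auto
  have s: "subfield ?E R" "subfield ?M R" by (intro adj_subfield fc Fc)+
  have i: "?E \<subseteq> E" "?M \<subseteq> M" using adj_frob_subset E M FE EM by auto
  have EM': "?E \<subseteq> ?M" using EM fc Fc by (intro adj_mono) auto
  have FE': "F \<subseteq> ?E" by (rule adj_base)
  have finEM: "finite_dimension E M" by (rule finite_dimension_tower(2)[OF Ff E M FE EM fin])
  have finE'M: "finite_dimension ?E M" 
    using finite_dimension_tower(2)[OF Ff s(1) M FE' _ fin] i EM by blast
  have t1: "dim ?E M = dim ?E E * dim E M"
    using deg_tower(2)[OF s(1) E finite_dimension_tower(1)[OF s(1) E M i(1) EM finE'M] finEM] .
  have t2: "dim ?E M = dim ?E ?M * dim ?M M"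
    using deg_tower(2)[OF s finite_dimension_tower[OF s(1) s(2) M EM' i(2) finE'M]] .
  have "dim ?E ?M \<le> dim (frob 1 ` E) (frob 1 ` M)"
    by (rule compositum_dim(2)[OF subfield_frob_image[OF M] subfield_frob_image[OF E] image_mono[OF EM] _ F])
      (rule frob_dim(1)[OF E finEM c(2)])
  also have "\<dots> = dim E M" by (rule frob_dim(2)[OF E finEM c(2)])
  finally have "dim ?E E * dim E M \<le> dim E M * dim ?M M" using t1 t2 by simp
  then show ?thesis using dim_pos[OF E M finEM] by (simp add: mult.commute)
qed

section \<open>Bounded rank\<close>

text \<open>
  For \<open>E = F(xs)\<close> the base of the tower is \<open>F(E^p)\<close>, so this is
  independence of \<open>xs\<close> modulo \<open>p\<close>-th powers of the field that
  \<open>xs\<close> itself generates. The condition refers to no field beyond \<open>F\<close>,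
  which makes it monotone under change of the base and of the ambient field.
\<close>

definition p_independent :: "'a set \<Rightarrow> 'a list \<Rightarrow> bool" where
  "p_independent F xs \<longleftrightarrow> strict_tower (adj F (frob 1 ` set xs)) xs"

text \<open>
  A bound on the lengths of all such sequences is the finite counterpart of a bound on the sizes
  of the \<open>r\<close>-bases of all levels.
\<close>

definition rank_le :: "'a set \<Rightarrow> 'a set \<Rightarrow> nat \<Rightarrow> bool" where
  "rank_le F L q \<longleftrightarrow> (\<forall>xs. set xs \<subseteq> L \<and> p_independent F xs \<longrightarrow> length xs \<le> q)"

lemma p_independent_antimono: "F \<subseteq> G \<Longrightarrow> G \<subseteq> carrier R \<Longrightarrow> set xs \<subseteq> carrier R \<Longrightarrow> p_independent G xs \<Longrightarrow> p_independent F xs"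
proof -
  assume a: "F \<subseteq> G" "G \<subseteq> carrier R" "set xs \<subseteq> carrier R" "p_independent G xs"
  then have f: "frob 1 ` set xs \<subseteq> carrier R" by auto
  show ?thesis using a(4) unfolding p_independent_def
    by (rule strict_tower_anti[rotated 3]) (use a f in \<open>auto intro!: adj_mono adj_carrier del: subsetI\<close>)
qed

lemma rank_le_mono:
  "rank_le F L q \<Longrightarrow> F \<subseteq> G \<Longrightarrow> M \<subseteq> L \<Longrightarrow> G \<subseteq> carrier R \<Longrightarrow> L \<subseteq> carrier R \<Longrightarrow> rank_le G M q"
  unfolding rank_le_def using p_independent_antimono[of F G] by (meson subset_trans)

lemma p_independent_of_strict_tower:
  assumes "subfield L R" "F \<subseteq> L" "set xs \<subseteq> L" "strict_tower (adj F (frob 1 ` L)) xs"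
  shows "p_independent F xs"
proof -
  have c: "L \<subseteq> carrier R" using assms(1) subfieldE(3) by blast
  note Fc = subset_trans[OF assms(2) c] and xc = subset_trans[OF assms(3) c]
  have fc: "frob 1 ` L \<subseteq> carrier R" using c frob_closed by blast
  show ?thesis unfolding p_independent_def
    by (rule strict_tower_anti[OF adj_mono[OF subset_refl image_mono[OF assms(3)] Fc fc]
          adj_carrier[OF Fc fc] xc assms(4)])
qed

text \<open>
  A longest sequence generates \<open>L\<close> modulo \<open>p\<close>-th powers; a bounded
  exponent removes these.
\<close>

lemma rank_generators:
  assumes F: "pinsep F" and L: "subfield L R" and FL: "F \<subseteq> L" and rk: "rank_le F L q" and ex: "frob n ` L \<subseteq> F"
  shows "\<exists>ws. set ws \<subseteq> L \<and> length ws \<le> q \<and> adj F (set ws) = L"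
proof -
  let ?G = "adj F (frob 1 ` L)"
  have c: "L \<subseteq> carrier R" "F \<subseteq> carrier R" using subfieldE(3)[OF L] FL by auto
  have fc: "frob 1 ` L \<subseteq> carrier R" using c by auto
  have G: "subfield ?G R" by (rule adj_subfield[OF c(2) fc])
  have "\<exists>ws. set ws \<subseteq> L \<and> length ws \<le> q \<and> strict_tower ?G ws \<and> adj ?G (set ws) = L"
    using p_independent_of_strict_tower[OF L FL] rk unfolding rank_le_def
    by (intro strict_tower_generators G L adj_frob_subset FL) auto
  then obtain ws where ws: "set ws \<subseteq> L" "length ws \<le> q" "adj ?G (set ws) = L" by blast
  have wc: "set ws \<subseteq> carrier R" using ws(1) c by auto
  have E: "subfield (adj F (set ws)) R" by (rule adj_subfield[OF c(2) wc])
  have EL: "adj F (set ws) \<subseteq> L" by (rule adj_least[OF L FL ws(1)])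
  have "adj (adj F (set ws)) (frob 1 ` L) = L"
    using ws(3) adj_adj[OF c(2) wc fc] adj_adj[OF c(2) fc wc] by (simp add: Un_commute)
  then have "adj (adj F (set ws)) (frob n ` L) = L" by (rule frobenius_nakayama[OF E L EL])
  moreover have "adj (adj F (set ws)) (frob n ` L) = adj F (set ws)"
    using ex adj_base[of F "set ws"] by (intro adj_absorb[OF E]) blast
  ultimately show ?thesis using ws by auto
qed

lemma p_independent_length_less_dim:
  assumes F: "pinsep F" and M: "subfield M R" and FM: "F \<subseteq> M" and fin: "finite_dimension F M"
    and xs: "set xs \<subseteq> M" "p_independent F xs"
  shows "length xs < dim (adj F (frob 1 ` M)) M"
proof -
  let ?E = "adj F (set xs)"
  note Ff = pinsep_subfield[OF F] and Fc = pinsep_carrier[OF F]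
  have xc: "set xs \<subseteq> carrier R" using xs(1) subfieldE(3)[OF M] by blast
  have fxc: "frob 1 ` set xs \<subseteq> carrier R" using xc by auto
  have E: "subfield ?E R" by (rule adj_subfield[OF Fc xc])
  have EM: "?E \<subseteq> M" by (rule adj_least[OF M FM xs(1)])
  have finE: "finite_dimension F ?E" by (rule finite_dimension_tower(1)[OF Ff E M adj_base EM fin])
  let ?E' = "adj F (frob 1 ` ?E)"
  have eq: "?E' = adj F (frob 1 ` set xs)" by (rule adj_frob_adj[OF Ff xc])
  have E': "subfield ?E' R" unfolding eq by (rule adj_subfield[OF Fc fxc])
  have E'E: "?E' \<subseteq> ?E" by (rule adj_frob_subset[OF E adj_base])
  have "length xs < dim ?E' ?E"
    using xs(2) unfolding p_independent_def eq[symmetric]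
    by (intro strict_tower_length E' E E'E adj_gens finite_dimension_tower(2)[OF Ff E' E adj_base E'E finE])
  also have "\<dots> \<le> dim (adj F (frob 1 ` M)) M"
    by (rule dim_mod_pth_powers_mono[OF F E M adj_base EM fin])
  finally show ?thesis .
qed

text \<open>
  The bound is the degree of the field over the subfield generated by \<open>F\<close> and the
  \<open>p\<close>-th powers. It is far from sharp, but only the boundedness of ranks is used.
\<close>

lemma p_independent_length_le:
  assumes F: "pinsep F" and ws: "set ws \<subseteq> carrier R" and xs: "set xs \<subseteq> adj F (set ws)" "p_independent F xs"
  shows "length xs \<le> p ^ length ws"
proof -
  let ?M = "adj F (set ws)"
  let ?M' = "adj F (frob 1 ` ?M)"
  note Fc = pinsep_carrier[OF F]
  have M: "subfield ?M R" by (rule adj_subfield[OF Fc ws])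
  have fMc: "frob 1 ` ?M \<subseteq> carrier R" using subfieldE(3)[OF M] by blast
  have M': "subfield ?M' R" by (rule adj_subfield[OF Fc fMc])
  have M'M: "?M' \<subseteq> ?M" by (rule adj_frob_subset[OF M adj_base])
  have "length xs < dim ?M' ?M"
    by (rule p_independent_length_less_dim[OF F M adj_base _ xs]) (use finite_adj[OF _ F ws] in simp)
  also have "dim ?M' ?M \<le> p ^ length ws"
  proof -
    have "adj ?M' (set ws) = ?M"
    proof (rule antisym)
      show "?M \<subseteq> adj ?M' (set ws)" using ws subfieldE(3)[OF M'] by (intro adj_mono adj_base) auto
      show "adj ?M' (set ws) \<subseteq> ?M" by (rule adj_least[OF M M'M adj_gens])
    qed
    moreover have "dim ?M' (adj ?M' (set ws)) \<le> p ^ length ws"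
      using dim_adj_pth_roots[OF M' ws] adj_gens[of "frob 1 ` ?M" F] adj_gens[of "set ws" F] by blast
    ultimately show ?thesis by simp
  qed
  finally show ?thesis by simp
qed

text \<open>
  Both layers have few generators, and few generators bound the length of independent sequences.
\<close>

lemma rank_le_trans:
  assumes k: "pinsep k" and m: "subfield m R" and L: "subfield L R" and km: "k \<subseteq> m" and mL: "m \<subseteq> L"
    and r1: "rank_le k m q1" and r2: "rank_le m L q2"
  shows "rank_le k L (p ^ (q1 + q2))"
  unfolding rank_le_def
proof (intro allI impI)
  fix xs assume xs: "set xs \<subseteq> L \<and> p_independent k xs"
  note kc = pinsep_carrier[OF k] and mc = subfieldE(3)[OF m] and Lc = subfieldE(3)[OF L]
  have pm: "pinsep m" by (rule pinsep_mono[OF k m km])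
  have xc: "set xs \<subseteq> carrier R" using xs Lc by blast
  let ?E = "adj m (set xs)"
  have E: "subfield ?E R" by (rule adj_subfield[OF mc xc])
  have EL: "?E \<subseteq> L" by (rule adj_least[OF L mL]) (use xs in blast)
  obtain n where "frob n ` ?E \<subseteq> m" using bounded_exponent[OF pm _ xc] by auto
  then obtain ys where ys: "set ys \<subseteq> ?E" "length ys \<le> q2" "adj m (set ys) = ?E"
    using rank_generators[OF pm E adj_base rank_le_mono[OF r2 subset_refl EL mc Lc]] by blast
  have yc: "set ys \<subseteq> carrier R" using ys(1) EL Lc by blast
  have my: "m \<union> set ys \<subseteq> carrier R" using mc yc by blast
  \<comment> \<open>The sequence involves only finitely many elements of \<open>m\<close>; these generate a finite extension of
    \<open>k\<close>, which has few generators by the bound on the rank of \<open>m\<close>.\<close>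
  have E_eq: "?E = adj k (m \<union> set ys)"
    using ys(3) adj_adj[OF kc mc yc] antisym[OF adj_least[OF m km subset_refl] adj_gens] by simp
  have fin_sup: "\<exists>T. finite T \<and> T \<subseteq> m \<union> set ys \<and> x \<in> adj k T" if "x \<in> set xs" for x
    by (rule adj_finite_support[OF kc my]) (use that adj_gens[of "set xs" m] E_eq in blast)
  then obtain T where T: "\<And>x. x \<in> set xs \<Longrightarrow> finite (T x) \<and> T x \<subseteq> m \<union> set ys \<and> x \<in> adj k (T x)"
    by metis
  define U where "U = (\<Union>x\<in>set xs. T x)"
  have U: "finite U" "U \<subseteq> m \<union> set ys" using T by (auto simp: U_def)
  have Uc: "U \<subseteq> carrier R" using U(2) my by blast
  have xU: "set xs \<subseteq> adj k U"
  proof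
    fix x assume x: "x \<in> set xs"
    have "T x \<subseteq> U" using x by (auto simp: U_def)
    then have "adj k (T x) \<subseteq> adj k U" by (intro adj_mono kc Uc) auto
    then show "x \<in> adj k U" using T[OF x] by blast
  qed
  let ?D = "adj k (U \<inter> m)"
  have Umc: "U \<inter> m \<subseteq> carrier R" using mc by blast
  have D: "subfield ?D R" by (rule adj_subfield[OF kc Umc])
  have Dm: "?D \<subseteq> m" by (rule adj_least[OF m km]) blast
  obtain n' where "frob n' ` ?D \<subseteq> k" using bounded_exponent[OF k _ Umc] U(1) by auto
  then obtain ws where ws: "set ws \<subseteq> ?D" "length ws \<le> q1" "adj k (set ws) = ?D"
    using rank_generators[OF k D adj_base rank_le_mono[OF r1 subset_refl Dm kc mc]] by blast
  have wc: "set ws \<subseteq> carrier R" using ws(1) Dm mc by blast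
  have wyc: "set (ws @ ys) \<subseteq> carrier R" using wc yc by simp
  have W: "subfield (adj k (set (ws @ ys))) R" by (rule adj_subfield[OF kc wyc])
  have "?D \<subseteq> adj k (set (ws @ ys))" unfolding ws(3)[symmetric] by (rule adj_mono[OF subset_refl _ kc wyc]) simp
  then have "U \<subseteq> adj k (set (ws @ ys))"
    using U(2) adj_gens[of "U \<inter> m" k] adj_gens[of "set (ws @ ys)" k] unfolding set_append by blast
  then have "adj k U \<subseteq> adj k (set (ws @ ys))" by (rule adj_least[OF W adj_base])
  then have "set xs \<subseteq> adj k (set (ws @ ys))" using xU by blast
  then have "length xs \<le> p ^ length (ws @ ys)" using xs by (intro p_independent_length_le[OF k wyc]) auto
  also have "\<dots> \<le> p ^ (q1 + q2)" using ws(2) ys(2) p_pos by (intro power_increasing) auto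
  finally show "length xs \<le> p ^ (q1 + q2)" .
qed

section \<open>Finite degree of irrationality means bounded rank\<close>

text \<open>
  Finite pieces of an \<open>r\<close>-base are relatively independent sequences.
\<close>

lemma r_base_card_le:
  assumes L: "subfield L R" and kL: "k \<subseteq> L" and rk: "rank_le k L q" and B: "r_base R p L k B"
  shows "finite B \<and> card B \<le> q"
proof (rule finite_if_finite_subsets_card_bdd)
  fix T assume T: "T \<subseteq> B" "finite T"
  let ?P = "adj k (frob 1 ` L)"
  note Lc = subfieldE(3)[OF L]
  have BL: "B \<subseteq> L" and Bi: "\<And>x. x \<in> B \<Longrightarrow> x \<notin> adj ?P (B - {x})"
    using B unfolding r_base_def frob_power_eq by auto
  have fc: "frob 1 ` L \<subseteq> carrier R" using Lc by auto
  have P: "subfield ?P R" by (rule adj_subfield[OF subset_trans[OF kL Lc] fc])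
  obtain xs where xs: "set xs = T" "distinct xs" using finite_distinct_list[OF T(2)] by blast
  have xL: "set xs \<subseteq> L" using xs T BL by simp
  have "x \<notin> adj ?P (set xs - {x})" if "x \<in> set xs" for x
  proof -
    have "adj ?P (set xs - {x}) \<subseteq> adj ?P (B - {x})"
      by (rule adj_mono[OF subset_refl _ subfieldE(3)[OF P]]) (use T(1) xs(1) BL Lc in blast)+
    then show ?thesis using Bi[of x] that xs T(1) by blast
  qed
  then have "strict_tower ?P xs" by (rule strict_tower_of_irredundant[OF P subset_trans[OF xL Lc] xs(2)])
  then have "p_independent k xs" by (rule p_independent_of_strict_tower[OF L kL xL])
  then show "card T \<le> q" using rk xL xs distinct_card[OF xs(2)] by (auto simp: rank_le_def)
qed

lemma level_field_eq: "level_field R p L k n = {x \<in> L. frob n x \<in> k}"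
  by (simp add: level_field_def frob_def)

text \<open>
  Any finite set lies in some level, and an \<open>r\<close>-base of a level generates it, since
  the level has bounded exponent.
\<close>

lemma rank_le_of_r_bases:
  assumes k: "pinsep k"
    and bd: "\<And>n B. 1 \<le> n \<Longrightarrow> r_base R p (level_field R p (carrier R) k n) k B \<Longrightarrow> finite B \<and> card B \<le> e"
  shows "rank_le k (carrier R) (p ^ e)"
  unfolding rank_le_def
proof (intro allI impI)
  fix xs assume xs: "set xs \<subseteq> carrier R \<and> p_independent k xs"
  note kf = pinsep_subfield[OF k] and kc = pinsep_carrier[OF k]
  obtain n where n: "frob n ` adj k (set xs) \<subseteq> k" using bounded_exponent[OF k _ conjunct1[OF xs]] by auto
  let ?K = "{x \<in> carrier R. frob (Suc n) x \<in> k}"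
  have K: "subfield ?K R" by (rule subfield_frob_vimage[OF carrier_is_subfield kf])
  have kK: "k \<subseteq> ?K" using kc frob_subfield[OF kf] by auto
  have xK: "set xs \<subseteq> ?K"
  proof
    fix x assume x: "x \<in> set xs"
    then have xc: "x \<in> carrier R" using xs by auto
    have "frob n x \<in> k" using n adj_gens[of "set xs" k] x by auto
    then have "frob (Suc n) x \<in> k" by (rule frob_level_mono[OF kf xc]) simp
    then show "x \<in> ?K" using xc by simp
  qed
  obtain B where B: "r_base R p ?K k B" using r_base_exists[OF K kK] by blast
  then have fB: "finite B" "card B \<le> e" using bd[of "Suc n" B] by (auto simp: level_field_eq)
  have BK: "B \<subseteq> ?K" and gen: "adj (adj k (frob 1 ` ?K)) B = ?K"
    using B unfolding r_base_def frob_power_eq by auto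
  have Bc: "B \<subseteq> carrier R" and fc: "frob 1 ` ?K \<subseteq> carrier R" using BK by auto
  have E: "subfield (adj k B) R" by (rule adj_subfield[OF kc Bc])
  have EK: "adj k B \<subseteq> ?K" by (rule adj_least[OF K kK BK])
  have "adj (adj k B) (frob 1 ` ?K) = ?K"
    using gen by (simp only: adj_adj[OF kc Bc fc] adj_adj[OF kc fc Bc] Un_commute)
  then have "adj (adj k B) (frob (Suc n) ` ?K) = ?K" by (rule frobenius_nakayama[OF E K EK])
  moreover have "adj (adj k B) (frob (Suc n) ` ?K) = adj k B"
    using adj_base[of k B] by (intro adj_absorb[OF E]) auto
  ultimately have KB: "?K = adj k B" by simp
  obtain ws where ws: "set ws = B" "distinct ws" using finite_distinct_list[OF fB(1)] by blast
  have "length xs \<le> p ^ length ws"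
    by (rule p_independent_length_le[OF k]) (use ws Bc xK KB xs in auto)
  also have "\<dots> \<le> p ^ e" using fB(2) distinct_card[OF ws(2)] ws(1) p_pos by (intro power_increasing) auto
  finally show "length xs \<le> p ^ e" .
qed

context includes cardinal_syntax begin

text \<open>
  The supremum of cardinals is finite exactly if the sizes of the \<open>r\<close>-bases are
  bounded by a natural number; the converse compares it with an \<open>r\<close>-base of largest
  size.
\<close>

lemma q_finite_iff_rank_le:
  assumes k: "pinsep k"
  shows "q_finite R p (carrier R) k \<longleftrightarrow> (\<exists>q. rank_le k (carrier R) q)"
proof
  let ?b = "\<lambda>n B. 1 \<le> n \<and> r_base R p (level_field R p (carrier R) k n) k B"
  define A where "A = {|B| | n B. ?b n B}"
  have co: "Card_order s" if "s \<in> A" for s using that card_of_Card_order unfolding A_def by blast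
  define r where "r = degree_of_irrationality R p (carrier R) k"
  have "r = card_sup A" by (simp add: r_def A_def degree_of_irrationality_def)
  then have sup: "is_card_sup A r" using is_card_sup_card_sup[OF co] by simp
  have r: "Card_order r" and ub: "\<And>s. s \<in> A \<Longrightarrow> s \<le>o r"
    and lub: "\<And>t::'a rel. Card_order t \<Longrightarrow> (\<And>s. s \<in> A \<Longrightarrow> s \<le>o t) \<Longrightarrow> r \<le>o t"
    using sup unfolding is_card_sup_def by blast+
  note Fr = card_of_Field_ordIso[OF r]
  note kf = pinsep_subfield[OF k] and kc = pinsep_carrier[OF k]
  show "\<exists>q. rank_le k (carrier R) q" if "q_finite R p (carrier R) k"
  proof -
    have fin: "finite (Field r)" using that by (simp add: q_finite_def r_def)
    have "finite B \<and> card B \<le> card (Field r)" if "1 \<le> n" "r_base R p (level_field R p (carrier R) k n) k B" for n B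
    proof -
      have "|B| \<in> A" using that unfolding A_def by blast
      then have le: "|B| \<le>o |Field r|" using ub ordLeq_ordIso_trans[OF _ ordIso_symmetric[OF Fr]] by blast
      then have fB: "finite B" by (rule card_of_ordLeq_finite[OF _ fin])
      then show ?thesis using le finite_card_of_le_iff[OF fB fin] by blast
    qed
    then show ?thesis using rank_le_of_r_bases[OF k] by blast
  qed
  show "q_finite R p (carrier R) k" if ex: "\<exists>q. rank_le k (carrier R) q"
  proof -
    obtain q where q: "rank_le k (carrier R) q" using ex by blast
    have lv: "subfield (level_field R p (carrier R) k n) R" "k \<subseteq> level_field R p (carrier R) k n"
      "level_field R p (carrier R) k n \<subseteq> carrier R" for n
      unfolding level_field_eq
      using subfield_frob_vimage[OF carrier_is_subfield kf] kc frob_subfield[OF kf] by auto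
    have bd: "finite B \<and> card B \<le> q" if "?b n B" for n B
      using r_base_card_le[OF lv(1,2) rank_le_mono[OF q subset_refl lv(3) kc subset_refl]] that by blast
    obtain B1 where "?b 1 B1" using r_base_exists[OF lv(1,2)] by blast
    then have "\<exists>B0. (\<exists>n. ?b n B0) \<and> (\<forall>B. (\<exists>n. ?b n B) \<longrightarrow> card B \<le> card B0)"
      using bd by (intro ex_has_greatest_nat[of _ B1 card "Suc q"]) (blast, force)
    then obtain B0 n0 where B0: "?b n0 B0" "\<And>n B. ?b n B \<Longrightarrow> card B \<le> card B0" by blast
    have f0: "finite B0" using bd[OF B0(1)] by blast
    have "r \<le>o |B0|"
    proof (rule lub)
      show "s \<le>o |B0|" if "s \<in> A" for s
      proof -
        obtain n B where s: "s = |B|" "?b n B" using \<open>s \<in> A\<close> unfolding A_def by blast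
        then show ?thesis using bd[OF s(2)] B0(2)[OF s(2)] finite_card_of_le_iff[of B B0] f0 by simp
      qed
    qed (rule card_of_Card_order)
    then have "|Field r| \<le>o |B0|" by (rule ordIso_ordLeq_trans[OF Fr])
    then show ?thesis using card_of_ordLeq_finite[OF _ f0] by (simp add: q_finite_def r_def)
  qed
qed

end

section \<open>Bounded rank implies the descending chain condition\<close>

text \<open>
  Let \<open>G\<close> be the intersection of the chain. If the elements of exponent one over
  \<open>G\<close> kept being lost along the chain, lost elements would form arbitrarily long
  independent sequences over \<open>G\<close>, hence over \<open>k\<close>. So from some point
  on no element outside \<open>G\<close> has exponent one over \<open>G\<close>, and by pure
  inseparability nothing outside \<open>G\<close> is left.
\<close>

lemma dcc_of_rank_le:
  assumes k: "pinsep k" and rk: "rank_le k (carrier R) q"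
  shows "dcc k"
  unfolding dcc_def
proof (intro allI impI)
  fix F :: "nat \<Rightarrow> 'a set"
  assume F: "(\<forall>n. intermediate_field R (carrier R) k (F n)) \<and> (\<forall>n. F (Suc n) \<subseteq> F n)"
  then have sf: "subfield (F n) R" and kF: "k \<subseteq> F n" and dec: "F (Suc n) \<subseteq> F n" for n
    by (simp_all add: intermediate_field_iff)
  have mono: "F n \<subseteq> F m" if "m \<le> n" for m n using lift_Suc_antimono_le[of F, OF dec that] .
  let ?G = "\<Inter>n. F n"
  have G: "subfield ?G R" by (rule subfield_Inter) (use sf in auto)
  have pG: "pinsep ?G" by (rule pinsep_mono[OF k G]) (use kF in auto)
  note Gc = subfieldE(3)[OF G]
  \<comment> \<open>The part of exponent one over the intersection; by pure inseparability it decides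
    whether the chain has reached its intersection.\<close>
  define D where "D = (\<lambda>n. {x \<in> F n. frob 1 x \<in> ?G})"
  have D: "subfield (D n) R" for n unfolding D_def by (rule subfield_frob_vimage[OF sf G])
  have Dmono: "D n \<subseteq> D m" if "m \<le> n" for m n using mono[OF that] by (auto simp: D_def)
  have GD: "?G \<subseteq> D n" for n using frob_subfield[OF G] by (auto simp: D_def)
  have "\<exists>N. \<forall>n\<ge>N. D (Suc n) = D n"
  proof (rule ccontr)
    assume neg: "\<not> (\<exists>N. \<forall>n\<ge>N. D (Suc n) = D n)"
    \<comment> \<open>Each strict drop contributes one element, and a later drop is to precede an earlier one in
      the sequence: an element lost at step \<open>n\<close> is outside the field generated by elements that survive.\<close>
    have "\<exists>xs. length xs = s \<and> set xs \<subseteq> D N \<and> strict_tower ?G xs" for s N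
    proof (induction s arbitrary: N)
      case 0
      show ?case by (intro exI[of _ "[]"]) simp
    next
      case (Suc s)
      obtain n where n: "n \<ge> N" "D (Suc n) \<noteq> D n" using neg by blast
      then obtain x where x: "x \<in> D n" "x \<notin> D (Suc n)" using Dmono[of n "Suc n"] by auto
      obtain ys where ys: "length ys = s" "set ys \<subseteq> D (Suc n)" "strict_tower ?G ys" using Suc.IH by blast
      have yc: "set ys \<subseteq> carrier R" using ys(2) subfieldE(3)[OF D] by blast
      have xc: "set [x] \<subseteq> carrier R" using x(1) subfieldE(3)[OF D] by auto
      have "adj ?G (set ys) \<subseteq> D (Suc n)" by (rule adj_least[OF D GD ys(2)])
      then have "strict_tower ?G (ys @ [x])"
        using ys(3) x(2) by (auto simp: strict_tower_append[OF G yc xc])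
      moreover have "set (ys @ [x]) \<subseteq> D N"
        using Dmono[OF n(1)] Dmono[of n "Suc n"] ys(2) x(1) by auto
      ultimately show ?case using ys(1) by (intro exI[of _ "ys @ [x]"]) simp
    qed
    then obtain xs where xs: "length xs = Suc q" "set xs \<subseteq> D 0" "strict_tower ?G xs" by blast
    have xc: "set xs \<subseteq> carrier R" using xs(2) subfieldE(3)[OF D] by blast
    have "adj k (frob 1 ` set xs) \<subseteq> ?G"
      using xs(2) kF by (intro adj_least[OF G]) (auto simp: D_def)
    then have "p_independent k xs" unfolding p_independent_def by (rule strict_tower_anti[OF _ Gc xc xs(3)])
    then have "length xs \<le> q" using rk xc by (simp add: rank_le_def)
    then show False using xs(1) by simp
  qed
  then obtain N where N: "\<And>n. n \<ge> N \<Longrightarrow> D (Suc n) = D n" by blast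
  have DN: "D n = D N" if "n \<ge> N" for n
    using that by (induction n rule: dec_induct) (simp_all add: N)
  have DG: "D N \<subseteq> ?G"
  proof
    fix x assume x: "x \<in> D N"
    have "x \<in> F n" for n
    proof -
      have "x \<in> D (max n N)" using DN[of "max n N"] x by simp
      then have "x \<in> F (max n N)" by (simp add: D_def)
      then show ?thesis using mono[of n "max n N"] by auto
    qed
    then show "x \<in> ?G" by blast
  qed
  have FN: "x \<in> ?G" if x: "x \<in> F N" for x
  proof -
    have xc: "x \<in> carrier R" using x subfieldE(3)[OF sf] by blast
    obtain m where "frob m x \<in> ?G" using pG xc unfolding pinsep_def by blast
    then show ?thesis
    proof (induction m)
      case 0
      then show ?case using xc by simp
    next
      case (Suc m)
      have "frob m x \<in> D N" using frob_subfield[OF sf x] Suc.prems xc by (simp add: D_def frob_add)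
      then show ?case using Suc.IH DG by blast
    qed
  qed
  have "F n = F N" if "n \<ge> N" for n using mono[OF that] FN by blast
  then show "\<exists>N. \<forall>n\<ge>N. F n = F N" by blast
qed

section \<open>Modular extensions\<close>

text \<open>
  If passing to the compositum does not lower the degree, a basis stays independent.
\<close>

lemma linearly_disjoint_dim:
  assumes A: "subfield A R" and B: "pinsep B" and C: "subfield C R" and CA: "C \<subseteq> A" and CB: "C \<subseteq> B"
    and fin: "finite_dimension C A" and d: "dim B (adj B A) = dim C A"
  shows "linearly_disjoint R C A B"
proof -
  note Bf = pinsep_subfield[OF B]
  obtain Us where Us: "set Us \<subseteq> carrier R" "Span C Us = A" "length Us = dim C A"
    using exists_base[OF C dim_dimension[OF C fin]] by blast
  have "adj B A = Span B Us" by (rule Span_compositum[OF A C Us(1,2) B CB])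
  then have "independent B Us" using d Us by (intro independent_of_dim[OF Bf Us(1)]) simp
  then have "linearly_disjoint R C B A"
    using Us(2) by (intro linearly_disjoint_of_basis[OF A Bf C CA CB]) blast
  then show ?thesis by (rule linearly_disjoint_sym[OF Bf A C CB CA])
qed

lemma modular_Int:
  assumes "subfield L R" "subfield M R" "subfield N R" "modular_extension R p L M" "modular_extension R p L N"
  shows "modular_extension R p L (M \<inter> N)"
  using assms linearly_disjoint_Int[OF subfield_frob_image[OF assms(1)] assms(2,3)]
  unfolding modular_extension_def frob_power_eq by blast

text \<open>
  For \<open>n = 0\<close> the smaller of the two fields is \<open>M\<close>, and for larger
  \<open>n\<close> it is \<open>L^(p^n)\<close>; in both cases it is also the intersection, over
  which nothing has to be shown.
\<close>

lemma modular_exponent_one: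
  assumes L: "subfield L R" and M: "subfield M R" and sub: "M \<subseteq> L" and ex: "frob 1 ` L \<subseteq> M"
  shows "modular_extension R p L M"
  unfolding modular_extension_def frob_power_eq
proof
  fix n
  have c: "L \<subseteq> carrier R" using subfieldE(3)[OF L] .
  show "linearly_disjoint R (frob n ` L \<inter> M) (frob n ` L) M"
  proof (cases n)
    case 0
    have "frob 0 ` L = L" using c by force
    then show ?thesis using 0 sub linearly_disjoint_right_base[of M L] by (simp add: Int_absorb1)
  next
    case (Suc k)
    have "frob n y \<in> M" if "y \<in> L" for y
    proof -
      have "frob 1 y \<in> M" "y \<in> carrier R" using ex that c by auto
      then show ?thesis using frob_subfield[OF M, of "frob 1 y" k] Suc by (simp add: frob_add)
    qed
    then have "frob n ` L \<subseteq> M" by blast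
    then show ?thesis
      using linearly_disjoint_left_base[OF subfield_frob_image[OF L] M] by (simp add: Int_absorb2)
  qed
qed

text \<open>
  A tower that descends by Frobenius with constant degrees behaves like a union of tensor
  products of simple extensions of equal exponent.
\<close>

lemma modular_tower:
  assumes T: "\<And>j. subfield (T j) R" and m: "pinsep (T 0)" and inc: "\<And>j. T j \<subseteq> T (Suc j)"
    and step: "\<And>j. adj (T 0) (frob 1 ` T (Suc j)) = T j"
    and fin: "\<And>j. finite_dimension (T j) (T (Suc j))" and d: "\<And>j. dim (T j) (T (Suc j)) = c"
  shows "modular_extension R p (\<Union>j. T j) (T 0)"
proof -
  note Tc = subfieldE(3)[OF T]
  have mono: "T i \<subseteq> T j" if "i \<le> j" for i j using lift_Suc_mono_le[of T, OF inc that] .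
  have dims: "finite_dimension (T i) (T (i + n)) \<and> dim (T i) (T (i + n)) = c ^ n" for i n
  proof (induction n)
    case 0
    show ?case using dimension_one[OF T, of i] finite_dimensionI dim_eqI[OF T, of 1 i "T i"] by auto
  next
    case (Suc n)
    then show ?case using deg_tower[OF T T _ fin, of i "i + n"] d by simp
  qed
  note down = tower_descend[of T, OF T inc step]
  show ?thesis unfolding modular_extension_def frob_power_eq
  proof
    fix i
    let ?L = "\<Union>j. T j"
    have L: "subfield ?L R" by (rule subfield_chain_Union[of T, OF T inc])
    note fL = subfield_frob_image[OF L, of i]
    \<comment> \<open>A subfield of \<open>L^(p^i)\<close> inside the base, over which \<open>T (i + n)^(p^i)\<close> has the degree
      \<open>c^n\<close> that its compositum \<open>T n\<close> with the base has over the base.\<close>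
    let ?C = "frob i ` T i"
    have CT: "?C \<subseteq> T 0" using down[of i 0] adj_gens[of ?C "T 0"] by simp
    have C: "subfield ?C R" by (rule subfield_frob_image[OF T])
    show "linearly_disjoint R (frob i ` ?L \<inter> T 0) (frob i ` ?L) (T 0)"
      unfolding linearly_disjoint_def
    proof (intro allI impI)
      fix Us assume Us: "set Us \<subseteq> frob i ` ?L \<and> independent (frob i ` ?L \<inter> T 0) Us"
      have "\<exists>n. set Us \<subseteq> frob i ` T (i + n)" if "set Us \<subseteq> frob i ` ?L" for Us
        using that
      proof (induction Us)
        case (Cons u Us)
        then obtain n y l where n: "set Us \<subseteq> frob i ` T (i + n)" "u = frob i y" "y \<in> T l" by auto
        have t: "T (i + n) \<subseteq> T (i + max n l)" "T l \<subseteq> T (i + max n l)" by (auto intro!: mono)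
        have "set (u # Us) \<subseteq> frob i ` T (i + max n l)"
          using subset_trans[OF n(1) image_mono[OF t(1)]] n(2,3) t(2) by auto
        then show ?case by blast
      qed simp
      then obtain n where n: "set Us \<subseteq> frob i ` T (i + n)" using Us by blast
      let ?A = "frob i ` T (i + n)"
      have A: "subfield ?A R" by (rule subfield_frob_image[OF T])
      have CA: "?C \<subseteq> ?A" by (intro image_mono mono) simp
      note fd = frob_dim[OF T conjunct1[OF dims] Tc, of i i n]
      have "linearly_disjoint R ?C ?A (T 0)"
      proof (rule linearly_disjoint_dim[OF A m C CA CT fd(1)])
        show "dim (T 0) (adj (T 0) ?A) = dim ?C ?A"
          using down[of i n] dims[of 0 n] dims[of i n] fd(2) by simp
      qed
      moreover have "independent ?C Us"
        using Us CT by (intro independent_anti[OF C subfield_Int[OF fL T]]) auto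
      ultimately show "independent (T 0) Us" using n by (simp add: linearly_disjoint_def)
    qed
  qed
qed

text \<open>
  The descending chain condition gives a minimal field over which \<open>L\<close> is modular;
  stability under intersection makes it least. This also shows that \<open>mod_field\<close>,
  defined by a definite description, denotes the intended field.
\<close>

lemma mod_field_least:
  assumes dcc: "dcc k" and L: "subfield L R" and kL: "k \<subseteq> L"
  shows "intermediate_field R L k (mod_field R p L k)" "modular_extension R p L (mod_field R p L k)"
    "\<And>m. intermediate_field R L k m \<Longrightarrow> modular_extension R p L m \<Longrightarrow> mod_field R p L k \<subseteq> m"
proof -
  let ?P = "\<lambda>m. intermediate_field R L k m \<and> modular_extension R p L m"
  have Lc: "L \<subseteq> carrier R" using subfieldE(3)[OF L] .
  have "modular_extension R p L L" using frob_subfield[OF L] by (intro modular_exponent_one L) auto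
  then have "?P L" using L kL by (simp add: intermediate_field_def)
  then obtain M where M: "?P M" "\<And>M'. ?P M' \<Longrightarrow> M' \<subseteq> M \<Longrightarrow> M' = M"
    using dcc_minimal[OF dcc, of L ?P] Lc by (auto simp: intermediate_field_def)
  have least: "M \<subseteq> m" if "?P m" for m
  proof -
    have sf: "subfield M R" "subfield m R" using M(1) that by (simp_all add: intermediate_field_def)
    have "?P (M \<inter> m)"
      using M(1) that modular_Int[OF L sf] subfield_Int[OF sf] by (auto simp: intermediate_field_def)
    then show ?thesis using M(2)[of "M \<inter> m"] by blast
  qed
  have "mod_field R p L k = M" unfolding mod_field_def
    by (rule Least_equality) (use M(1) least in auto)
  then show "intermediate_field R L k (mod_field R p L k)" "modular_extension R p L (mod_field R p L k)"
    "\<And>m. intermediate_field R L k m \<Longrightarrow> modular_extension R p L m \<Longrightarrow> mod_field R p L k \<subseteq> m"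
    using M(1) least by auto
qed

text \<open>
  Removing the elements of an infinite \<open>r\<close>-base one by one would give a strictly
  decreasing chain.
\<close>

lemma dcc_finite_level:
  assumes dcc: "dcc k" and m: "pinsep m" and km: "k \<subseteq> m" and L: "subfield L R" and mL: "m \<subseteq> L"
  shows "finite_dimension m {x \<in> L. frob 1 x \<in> m}"
proof -
  let ?M = "{x \<in> L. frob 1 x \<in> m}"
  note mf = pinsep_subfield[OF m] and mc = pinsep_carrier[OF m] and Lc = subfieldE(3)[OF L]
  have M: "subfield ?M R" by (rule subfield_frob_vimage[OF L mf])
  have mM: "m \<subseteq> ?M" using mL frob_subfield[OF mf] by auto
  obtain B where B: "r_base R p ?M m B" using r_base_exists[OF M mM] by blast
  have e: "adj m (frob 1 ` ?M) = m" by (rule adj_absorb[OF mf]) auto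
  have BM: "B \<subseteq> ?M" and gen: "?M = adj m B" and Bi: "\<And>x. x \<in> B \<Longrightarrow> x \<notin> adj m (B - {x})"
    using B unfolding r_base_def frob_power_eq e by blast+
  have Bc: "B \<subseteq> carrier R" using BM Lc by blast
  have "finite B"
  proof (rule ccontr)
    assume "infinite B"
    then obtain b :: "nat \<Rightarrow> 'a" where b: "inj b" "range b \<subseteq> B" using infinite_countable_subset by blast
    define F where "F = (\<lambda>n. adj m (B - b ` {..<n}))"
    have c: "B - b ` {..<n} \<subseteq> carrier R" for n using Bc by blast
    have "intermediate_field R (carrier R) k (F n)" for n
      unfolding intermediate_field_iff F_def
      using adj_subfield[OF mc c] adj_carrier[OF mc c] adj_base[of m] km by blast
    moreover have "F (Suc n) \<subseteq> F n" for n
      unfolding F_def by (rule adj_mono[OF subset_refl _ mc c]) auto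
    ultimately have "(\<forall>n. intermediate_field R (carrier R) k (F n)) \<and> (\<forall>n. F (Suc n) \<subseteq> F n)" by blast
    from mp[OF spec[OF dcc[unfolded dcc_def]] this] obtain N where N: "\<forall>n\<ge>N. F n = F N" by (elim exE)
    have "b N \<in> B - b ` {..<N}" using b by (auto simp: inj_def)
    then have "b N \<in> F N" unfolding F_def using adj_gens[of _ m] by blast
    then have "b N \<in> F (Suc N)" using N by (metis le_SucI le_refl)
    moreover have "F (Suc N) \<subseteq> adj m (B - {b N})"
      unfolding F_def using Bc by (intro adj_mono mc) auto
    ultimately show False using Bi[of "b N"] b(2) by blast
  qed
  then show ?thesis using finite_adj[OF _ m Bc] gen by simp
qed

text \<open>
  Modularity makes the first level control all others. For a finite extension \<open>E\<close>
  of \<open>m\<close> that contains the first level \<open>M\<close>, linear disjointness gives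
  \<open>[E:M] = [E^p:M^p] \<le> [m(E^p):m]\<close>, and comparison with \<open>[E:m]\<close>
  leaves \<open>[E:m(E^p)] \<le> [M:m]\<close>.
\<close>

lemma modular_rank_le:
  assumes m: "pinsep m" and L: "subfield L R" and mL: "m \<subseteq> L" and md: "modular_extension R p L m"
    and fin: "finite_dimension m {x \<in> L. frob 1 x \<in> m}"
  shows "rank_le m L (dim m {x \<in> L. frob 1 x \<in> m})"
  unfolding rank_le_def
proof (intro allI impI)
  let ?M = "{x \<in> L. frob 1 x \<in> m}"
  fix xs assume xs: "set xs \<subseteq> L \<and> p_independent m xs"
  note mf = pinsep_subfield[OF m] and mc = pinsep_carrier[OF m] and Lc = subfieldE(3)[OF L]
  have xc: "set xs \<subseteq> carrier R" using xs Lc by blast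
  have M: "subfield ?M R" by (rule subfield_frob_vimage[OF L mf])
  have mM: "m \<subseteq> ?M" using mL frob_subfield[OF mf] by auto
  have pM: "pinsep ?M" by (rule pinsep_mono[OF m M mM])
  let ?E = "adj ?M (set xs)"
  have E: "subfield ?E R" by (rule adj_subfield[OF pinsep_carrier[OF pM] xc])
  have EL: "?E \<subseteq> L" by (rule adj_least[OF L]) (use xs in auto)
  have Ec: "?E \<subseteq> carrier R" using EL Lc by blast
  have ME: "?M \<subseteq> ?E" by (rule adj_base)
  have mE: "m \<subseteq> ?E" using mM ME by blast
  have finME: "finite_dimension ?M ?E" by (rule finite_adj[OF _ pM xc]) simp
  have finmE: "finite_dimension m ?E" by (rule deg_tower(1)[OF mf M fin finME])
  let ?E' = "adj m (frob 1 ` ?E)"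
  have fEc: "frob 1 ` ?E \<subseteq> carrier R" using Ec by auto
  have E': "subfield ?E' R" by (rule adj_subfield[OF mc fEc])
  have E'E: "?E' \<subseteq> ?E" by (rule adj_frob_subset[OF E mE])
  note finE' = finite_dimension_tower[OF mf E' E adj_base E'E finmE]
  have fM: "subfield (frob 1 ` ?M) R" by (rule subfield_frob_image[OF M])
  \<comment> \<open>Modularity enters here: a basis of \<open>E^p\<close> over \<open>M^p = L^p \<inter> m\<close> stays independent over \<open>m\<close>.\<close>
  have "dim ?M ?E \<le> dim m ?E'"
  proof -
    note fd = frob_dim[OF M finME Ec, of 1]
    obtain Us where Us: "set Us \<subseteq> carrier R" "independent (frob 1 ` ?M) Us"
      "length Us = dim (frob 1 ` ?M) (frob 1 ` ?E)" "Span (frob 1 ` ?M) Us = frob 1 ` ?E"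
      using exists_base[OF fM dim_dimension[OF fM fd(1)]] by blast
    have UE: "set Us \<subseteq> frob 1 ` ?E" using Span_base_incl[OF fM Us(1)] Us(4) by simp
    have eq: "frob 1 ` L \<inter> m = frob 1 ` ?M" by auto
    have "linearly_disjoint R (frob 1 ` ?M) (frob 1 ` L) m"
      using md unfolding modular_extension_def frob_power_eq eq[symmetric] by blast
    then have "independent m Us" using Us(2) UE EL unfolding linearly_disjoint_def by blast
    moreover have "set Us \<subseteq> ?E'" using UE adj_gens[of "frob 1 ` ?E" m] by blast
    ultimately have "length Us \<le> dim m ?E'"
      by (rule independent_length_le_dimension[OF mf dim_dimension[OF mf finE'(1)]])
    then show ?thesis using Us(3) fd(2) by simp
  qed
  moreover have "dim m ?E' * dim ?E' ?E = dim m ?M * dim ?M ?E"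
    using deg_tower(2)[OF mf E' finE'] deg_tower(2)[OF mf M fin finME] by simp
  ultimately have "dim m ?E' * dim ?E' ?E \<le> dim m ?M * dim m ?E'" by simp
  then have "dim ?E' ?E \<le> dim m ?M" using dim_pos[OF mf E' finE'(1)] by (simp add: mult.commute)
  moreover have "length xs < dim ?E' ?E"
    by (rule p_independent_length_less_dim[OF m E mE finmE]) (use xs adj_gens[of "set xs" ?M] in auto)
  ultimately show "length xs \<le> dim m ?M" by simp
qed

section \<open>Proper subfields over which an extension is modular\<close>

text \<open>
  The tower consists of the elements of the levels that remain infinitely divisible under
  Frobenius, in the way a divisible subgroup is extracted from a group with descending chain
  condition.
\<close>

lemma exists_tower:
  assumes k: "pinsep k" and dcc: "dcc k" and L: "subfield L R" and kL: "k \<subseteq> L" and neq: "L \<noteq> k"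
    and perf: "adj k (frob 1 ` L) = L"
  shows "\<exists>T. T 0 = k \<and> (\<forall>j. subfield (T j) R \<and> T j \<subseteq> T (Suc j) \<and> T j \<subseteq> L \<and>
    adj k (frob 1 ` T (Suc j)) = T j \<and> T (Suc j) \<noteq> T j)"
proof -
  note kf = pinsep_subfield[OF k] and kc = pinsep_carrier[OF k] and Lc = subfieldE(3)[OF L]
  define K where "K = (\<lambda>n. {x \<in> L. frob n x \<in> k})"
  have K: "subfield (K n) R" and KL: "K n \<subseteq> L" and kK: "k \<subseteq> K n" for n
    unfolding K_def using subfield_frob_vimage[OF L kf] kL frob_subfield[OF kf] by auto
  have frK: "frob i y \<in> K n" if "y \<in> K (n + i)" for n i y
  proof -
    have "y \<in> L" "y \<in> carrier R" "frob (n + i) y \<in> k" using that Lc by (auto simp: K_def)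
    then show ?thesis using frob_subfield[OF L] by (simp add: K_def frob_add)
  qed
  \<comment> \<open>For fixed \<open>j\<close> the fields \<open>k(K\<^sub>n^(p^(n-j)))\<close> lie in \<open>K\<^sub>j\<close> and decrease with \<open>n = j + i\<close>;
    their limit is the \<open>j\<close>-th step of the tower.\<close>
  define V where "V = (\<lambda>j i. adj k (frob i ` K (j + i)))"
  have ic: "frob i ` K n \<subseteq> carrier R" for i n using KL Lc by blast
  have V: "subfield (V j i) R" for j i unfolding V_def by (rule adj_subfield[OF kc ic])
  have kV: "k \<subseteq> V j i" for j i unfolding V_def by (rule adj_base)
  have frob_Suc: "frob (Suc i) y = frob i (frob 1 y)" "frob (Suc i) y = frob 1 (frob i y)" if "y \<in> K n" for i y n
  proof -
    have "y \<in> carrier R" by (rule subsetD[OF Lc subsetD[OF KL that]])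
    then show "frob (Suc i) y = frob i (frob 1 y)" "frob (Suc i) y = frob 1 (frob i y)" by (simp_all add: frob_add)
  qed
  have Vdec: "V j (Suc i) \<subseteq> V j i" for j i
  proof -
    have "frob (Suc i) y \<in> frob i ` K (j + i)" if "y \<in> K (j + Suc i)" for y
      unfolding frob_Suc(1)[OF that, where i = i] by (rule imageI, rule frK) (use that in simp)
    then show ?thesis unfolding V_def by (intro adj_mono kc ic) auto
  qed
  have "\<exists>N. \<forall>i\<ge>N. V j i = V j N" for j
  proof -
    have "(\<forall>i. intermediate_field R (carrier R) k (V j i)) \<and> (\<forall>i. V j (Suc i) \<subseteq> V j i)"
      using V kV Vdec subfieldE(3)[OF V] by (simp add: intermediate_field_iff)
    then show ?thesis by (rule mp[OF spec[OF dcc[unfolded dcc_def]]])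
  qed
  then obtain N where N: "\<And>j i. i \<ge> N j \<Longrightarrow> V j i = V j (N j)" by metis
  define T where "T = (\<lambda>j. V j (N j))"
  have TV: "T j = V j i" if "i \<ge> N j" for i j using N[OF that] by (simp add: T_def)
  have T: "subfield (T j) R" for j by (simp add: T_def V)
  have kT: "k \<subseteq> T j" for j by (simp add: T_def kV)
  have TL: "T j \<subseteq> L" for j
    unfolding T_def V_def using KL frob_subfield[OF L] by (intro adj_least[OF L kL]) auto
  have T0: "T 0 = k"
  proof -
    have "frob (N 0) ` K (N 0) \<subseteq> k" by (auto simp: K_def)
    then show ?thesis unfolding T_def V_def by (simp add: adj_absorb[OF kf])
  qed
  have step: "adj k (frob 1 ` T (Suc j)) = T j" for j
  proof -
    let ?i = "max (N j) (N (Suc j))"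
    have "adj k (frob 1 ` T (Suc j)) = adj k (frob 1 ` frob ?i ` K (Suc j + ?i))"
      using TV[of "Suc j" ?i] adj_frob_adj[OF kf ic] by (simp add: V_def)
    also have "frob 1 ` frob ?i ` K (Suc j + ?i) = frob (Suc ?i) ` K (j + Suc ?i)"
      using frob_Suc(2)[of _ "Suc j + ?i" ?i] by (force simp: image_image)
    also have "adj k \<dots> = T j" using TV[of j "Suc ?i"] by (simp add: V_def)
    finally show ?thesis .
  qed
  have inc: "T j \<subseteq> T (Suc j)" for j
    using adj_frob_subset[OF T kT, of j "Suc j"] step[of j] adj_frob_subset[OF T[of "Suc j"] kT] by metis
  have perf': "adj k (frob n ` L) = L" for n by (rule frobenius_nakayama[OF kf L kL perf])
  have T1: "T 1 \<noteq> k"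
  proof
    assume eq: "T 1 = k"
    let ?i = "N 1"
    have "frob ?i ` K (Suc ?i) \<subseteq> k" using eq adj_gens[of "frob ?i ` K (Suc ?i)" k] by (simp add: T_def V_def)
    then have S: "K (Suc ?i) \<subseteq> K ?i" by (auto simp: K_def)
    \<comment> \<open>Two equal consecutive levels stop the growth of all later ones, so that \<open>L\<close> would have
      bounded exponent, which is impossible when \<open>L = k(L^p)\<close> and \<open>L \<noteq> k\<close>.\<close>
    have all: "K (?i + n) \<subseteq> K ?i" for n
    proof (induction n)
      case (Suc n)
      show ?case
      proof
        fix x assume x: "x \<in> K (?i + Suc n)"
        then have "frob 1 x \<in> K ?i" using frK[of x "?i + n" 1] Suc by auto
        then have "frob ?i (frob 1 x) \<in> k" by (simp add: K_def)
        then have "frob (Suc ?i) x \<in> k" unfolding frob_Suc(1)[OF x, where i = ?i] .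
        then have "x \<in> K (Suc ?i)" using x by (simp add: K_def)
        then show "x \<in> K ?i" using S by blast
      qed
    qed simp
    have "frob ?i x \<in> k" if x: "x \<in> L" for x
    proof -
      have xc: "x \<in> carrier R" using x Lc by blast
      obtain n where "frob n x \<in> k" using k xc unfolding pinsep_def by blast
      then have "frob (?i + n) x \<in> k" by (rule frob_level_mono[OF kf xc]) simp
      then have "x \<in> K (?i + n)" using x by (simp add: K_def)
      then have "x \<in> K ?i" using all by blast
      then show ?thesis by (simp add: K_def)
    qed
    then have "adj k (frob ?i ` L) = k" by (intro adj_absorb[OF kf]) blast
    then show False using perf' neq by simp
  qed
  have frT: "frob j ` T j \<subseteq> k" for j
    using tower_descend[of T j 0, OF T inc] step T0 adj_gens[of "frob j ` T j" k] by simp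
  have strict: "T (Suc j) \<noteq> T j" for j
  proof
    assume eq: "T (Suc j) = T j"
    then have "adj k (frob 1 ` T j) = T j" using step[of j] by simp
    then have "adj k (frob j ` T j) = T j" by (rule frobenius_nakayama[OF kf T kT])
    then have "T j = k" using adj_absorb[OF kf frT] by simp
    then have "T (Suc j) = k" using eq by simp
    moreover have "T 1 \<subseteq> T (Suc j)" using lift_Suc_mono_le[of T, OF inc] by simp
    ultimately show False using T1 kT[of 1] by blast
  qed
  show ?thesis using T0 T inc TL step strict by (intro exI[of _ T]) simp
qed

text \<open>
  The degrees of the steps do not decrease and are bounded by the rank, so they are constant
  from some step on, and \<open>L\<close> is modular over that step.
\<close>

lemma modular_over_proper_of_tower:
  assumes k: "pinsep k" and rk: "rank_le k L d" and Lc: "L \<subseteq> carrier R"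
    and T0: "T 0 = k" and T: "\<And>j. subfield (T j) R" and inc: "\<And>j. T j \<subseteq> T (Suc j)"
    and step: "\<And>j. adj k (frob 1 ` T (Suc j)) = T j" and strict: "\<And>j. T (Suc j) \<noteq> T j"
    and un: "(\<Union>j. T j) = L"
  shows "\<exists>m. intermediate_field R L k m \<and> modular_extension R p L m \<and> m \<noteq> L"
proof -
  note kf = pinsep_subfield[OF k] and kc = pinsep_carrier[OF k]
  have mono: "T i \<subseteq> T j" if "i \<le> j" for i j using lift_Suc_mono_le[of T, OF inc that] .
  have kT: "k \<subseteq> T j" for j using mono[of 0 j] T0 by simp
  have TL: "T j \<subseteq> L" for j using un by blast
  have Tc: "T j \<subseteq> carrier R" for j using subfieldE(3)[OF T] .
  have frS: "frob 1 ` T (Suc j) \<subseteq> T j" for j using step[of j] adj_gens[of "frob 1 ` T (Suc j)" k] by simp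
  have frT: "frob j ` T j \<subseteq> k" for j
    using tower_descend[of T j 0, OF T inc] step T0 adj_gens[of "frob j ` T j" k] by simp
  define c where "c = (\<lambda>j. dim (T j) (T (Suc j)))"
  have fin: "finite_dimension (T j) (T (Suc j))" and cb: "c j \<le> p ^ d" for j
  proof -
    obtain ws where ws: "set ws \<subseteq> T (Suc j)" "length ws \<le> d" "adj k (set ws) = T (Suc j)"
      using rank_generators[OF k T kT rank_le_mono[OF rk subset_refl TL kc Lc] frT] by blast
    have wc: "set ws \<subseteq> carrier R" using ws(1) Tc by blast
    have "adj (T j) (set ws) = T (Suc j)"
    proof (rule antisym)
      show "adj (T j) (set ws) \<subseteq> T (Suc j)" by (rule adj_least[OF T inc ws(1)])
      show "T (Suc j) \<subseteq> adj (T j) (set ws)"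
        unfolding ws(3)[symmetric] by (rule adj_mono[OF kT subset_refl Tc wc])
    qed
    moreover have "frob 1 w \<in> T j" if "w \<in> set ws" for w using frS ws(1) that by blast
    ultimately have *: "finite_dimension (T j) (T (Suc j)) \<and> c j \<le> p ^ length ws"
      using dim_adj_pth_roots[OF T wc, of j] by (simp add: c_def)
    then show "finite_dimension (T j) (T (Suc j))" by blast
    have "p ^ length ws \<le> p ^ d" using ws(2) p_pos by (intro power_increasing) auto
    then show "c j \<le> p ^ d" using * by linarith
  qed
  \<comment> \<open>Frobenius preserves the degree of \<open>T (j + 2)\<close> over \<open>T (j + 1)\<close>, and adjoining \<open>k\<close> can only
    lower it.\<close>
  have "c j \<le> c (Suc j)" for j
  proof -
    note fd = frob_dim[OF T[of "Suc j"] fin[of "Suc j"] Tc, where m = 1]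
    have "dim (adj k (frob 1 ` T (Suc j))) (adj k (frob 1 ` T (Suc (Suc j)))) \<le>
        dim (frob 1 ` T (Suc j)) (frob 1 ` T (Suc (Suc j)))"
      by (rule compositum_dim(2)[OF subfield_frob_image[OF T] subfield_frob_image[OF T] image_mono[OF inc] fd(1) k])
    then show ?thesis unfolding step fd(2) c_def .
  qed
  then obtain J where J: "\<And>j. j \<ge> J \<Longrightarrow> c j = c J" using bounded_incseq_nat_const[of c, OF _ cb] by blast
  define T' where "T' = (\<lambda>i. T (J + i))"
  have "modular_extension R p (\<Union>i. T' i) (T' 0)"
  proof (rule modular_tower)
    show "pinsep (T' 0)" unfolding T'_def by (rule pinsep_mono[OF k T kT])
    show "adj (T' 0) (frob 1 ` T' (Suc i)) = T' i" for i
    proof (rule antisym)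
      show "adj (T' 0) (frob 1 ` T' (Suc i)) \<subseteq> T' i"
        unfolding T'_def using frS[of "J + i"] by (intro adj_least[OF T] mono) auto
      have "T' i = adj k (frob 1 ` T' (Suc i))" using step[of "J + i"] by (simp add: T'_def)
      also have "\<dots> \<subseteq> adj (T' 0) (frob 1 ` T' (Suc i))"
        unfolding T'_def by (rule adj_mono[OF kT subset_refl Tc]) (use Tc in blast)
      finally show "T' i \<subseteq> adj (T' 0) (frob 1 ` T' (Suc i))" .
    qed
    show "dim (T' i) (T' (Suc i)) = c J" for i using J[of "J + i"] by (simp add: T'_def c_def)
  qed (simp_all add: T'_def T inc fin)
  moreover have "(\<Union>i. T' i) = L"
  proof -
    have "T j \<subseteq> T' j" for j unfolding T'_def by (rule mono) simp
    then show ?thesis using un unfolding T'_def by blast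
  qed
  ultimately have md: "modular_extension R p L (T J)" by (simp add: T'_def)
  have "T J \<noteq> L" using TL[of "Suc J"] inc[of J] strict[of J] by blast
  then show ?thesis using md T[of J] kT[of J] TL[of J]
    by (intro exI[of _ "T J"]) (simp add: intermediate_field_iff)
qed

text \<open>
  An independent sequence over the union \<open>M\<close> of full length \<open>d + 1\<close>
  could not be extended by any element of \<open>M\<close> over \<open>k\<close>. This forces
  \<open>M\<close> into the finite extension \<open>k(xs)\<close>, which has bounded exponent,
  whereas \<open>M = k(M^p)\<close> is different from \<open>k\<close>.
\<close>

lemma rank_drop:
  assumes k: "pinsep k" and L: "subfield L R" and rk: "rank_le k L (Suc d)"
    and T0: "T 0 = k" and T: "\<And>j. subfield (T j) R" and inc: "\<And>j. T j \<subseteq> T (Suc j)"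
    and step: "\<And>j. adj k (frob 1 ` T (Suc j)) = T j" and strict: "\<And>j. T (Suc j) \<noteq> T j"
    and TL: "\<And>j. T j \<subseteq> L"
  shows "rank_le (\<Union>j. T j) L d"
  unfolding rank_le_def
proof (intro allI impI)
  let ?M = "\<Union>j. T j"
  note kf = pinsep_subfield[OF k] and kc = pinsep_carrier[OF k] and Lc = subfieldE(3)[OF L]
  have M: "subfield ?M R" by (rule subfield_chain_Union[of T, OF T inc])
  have Mc: "?M \<subseteq> carrier R" using subfieldE(3)[OF M] .
  have kM: "k \<subseteq> ?M" using T0 by blast
  fix xs assume xs: "set xs \<subseteq> L \<and> p_independent ?M xs"
  then have xc: "set xs \<subseteq> carrier R" using Lc by blast
  show "length xs \<le> d"
  proof (rule ccontr)
    assume long: "\<not> length xs \<le> d"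
    let ?E = "adj k (set xs)"
    have E: "subfield ?E R" by (rule adj_subfield[OF kc xc])
    have Ec: "?E \<subseteq> carrier R" using subfieldE(3)[OF E] .
    \<comment> \<open>Otherwise \<open>t # xs\<close> would be relatively independent over \<open>k\<close> and too long.\<close>
    have gen: "t \<in> adj ?E {frob 1 t}" if t: "t \<in> ?M" for t
    proof -
      have tc: "t \<in> carrier R" using t Mc by blast
      let ?Q = "adj k (frob 1 ` set (t # xs))"
      have qc: "frob 1 ` set (t # xs) \<subseteq> carrier R" using tc xc by auto
      have "\<not> p_independent k (t # xs)"
      proof
        assume "p_independent k (t # xs)"
        moreover have "t \<in> L" using t TL by blast
        then have "set (t # xs) \<subseteq> L" using xs by simp
        ultimately have "length (t # xs) \<le> Suc d" using rk unfolding rank_le_def by blast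
        then show False using long by simp
      qed
      moreover have "strict_tower (adj ?Q {t}) xs"
      proof (rule strict_tower_anti)
        let ?P = "adj ?M (frob 1 ` set xs)"
        have pc: "frob 1 ` set xs \<subseteq> carrier R" using xc by auto
        have P: "subfield ?P R" by (rule adj_subfield[OF Mc pc])
        show "?P \<subseteq> carrier R" using subfieldE(3)[OF P] .
        have MP: "?M \<subseteq> ?P" by (rule adj_base)
        have "frob 1 t \<in> ?P" using frob_subfield[OF M t] MP by blast
        then have "?Q \<subseteq> ?P"
          using kM MP adj_gens[of "frob 1 ` set xs" ?M] by (intro adj_least[OF P]) auto
        moreover have "{t} \<subseteq> ?P" using t MP by blast
        ultimately show "adj ?Q {t} \<subseteq> ?P" by (rule adj_least[OF P])
        show "strict_tower ?P xs" using xs by (simp add: p_independent_def)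
      qed (rule xc)
      ultimately have tQ: "t \<in> ?Q" by (auto simp: p_independent_def)
      have "?Q \<subseteq> adj ?E {frob 1 t}"
      proof (rule adj_least)
        show "subfield (adj ?E {frob 1 t}) R" using tc by (intro adj_subfield[OF Ec]) auto
        show "k \<subseteq> adj ?E {frob 1 t}" using adj_base[of k "set xs"] adj_base[of ?E "{frob 1 t}"] by blast
        have "frob 1 ` set xs \<subseteq> ?E" using frob_subfield[OF E] adj_gens[of "set xs" k] by blast
        then show "frob 1 ` set (t # xs) \<subseteq> adj ?E {frob 1 t}"
          using adj_base[of ?E "{frob 1 t}"] adj_gens[of "{frob 1 t}" ?E] by auto
      qed
      then show ?thesis using tQ by blast
    qed
    have gen_n: "t \<in> adj ?E {frob n t}" if t: "t \<in> ?M" for t n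
    proof (induction n)
      case 0
      have "frob 0 t = t" using subsetD[OF Mc t] by simp
      then show ?case using adj_gens[of "{t}" ?E] by simp
    next
      case (Suc n)
      have tc: "t \<in> carrier R" using t Mc by blast
      have S: "subfield (adj ?E {frob (Suc n) t}) R" using tc by (intro adj_subfield[OF Ec]) auto
      have "frob n t \<in> ?M" by (rule frob_subfield[OF M t])
      then have "frob n t \<in> adj ?E {frob (Suc n) t}" using gen[of "frob n t"] tc by (simp add: frob_add)
      then have "adj ?E {frob n t} \<subseteq> adj ?E {frob (Suc n) t}" by (intro adj_least[OF S adj_base]) simp
      then show ?case using Suc by blast
    qed
    have ME: "?M \<subseteq> ?E"
    proof
      fix t assume t: "t \<in> ?M"
      then have tc: "t \<in> carrier R" using Mc by blast
      obtain n where "frob n t \<in> k" using k tc unfolding pinsep_def by blast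
      then have "adj ?E {frob n t} = ?E" using adj_base[of k "set xs"] by (intro adj_absorb[OF E]) blast
      then show "t \<in> ?E" using gen_n[OF t, of n] by simp
    qed
    obtain n where n: "frob n ` ?E \<subseteq> k" using bounded_exponent[OF k _ xc] by auto
    have "frob n ` T (n + 1) \<subseteq> k" using n ME by blast
    then have "adj k (frob n ` T (n + 1)) = k" by (rule adj_absorb[OF kf])
    moreover have "adj k (frob n ` T (n + 1)) = T 1"
      using tower_descend[of T n 1, OF T inc] step T0 by simp
    ultimately show False using strict[of 0] T0 by simp
  qed
qed

text \<open>
  If \<open>L \<noteq> k(L^p)\<close> then \<open>k(L^p)\<close> will do. Otherwise take the
  union of the tower: if it is \<open>L\<close>, some step of the tower will do, and if it is
  smaller, it is a new base over which the rank has dropped.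
\<close>

lemma exists_proper_modular:
  assumes L: "subfield L R"
  shows "pinsep k \<Longrightarrow> dcc k \<Longrightarrow> k \<subseteq> L \<Longrightarrow> L \<noteq> k \<Longrightarrow> rank_le k L d \<Longrightarrow>
    \<exists>m. intermediate_field R L k m \<and> modular_extension R p L m \<and> m \<noteq> L"
proof (induction d arbitrary: k)
  case 0
  note kf = pinsep_subfield[OF 0(1)] and kc = pinsep_carrier[OF 0(1)] and Lc = subfieldE(3)[OF L]
  have "x \<in> k" if x: "x \<in> L" for x
  proof -
    have xc: "x \<in> carrier R" using x Lc by blast
    obtain n where "frob n x \<in> k" using 0(1) xc unfolding pinsep_def by blast
    then show ?thesis
    proof (induction n)
      case 0
      then show ?case using xc by simp
    next
      case (Suc n)
      let ?y = "frob n x"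
      have y: "?y \<in> L" "frob 1 ?y \<in> k" using frob_subfield[OF L x] Suc.prems xc by (simp_all add: frob_add)
      have "\<not> p_independent k [?y]" using spec[OF \<open>rank_le k L 0\<close>[unfolded rank_le_def], of "[?y]"] y(1) by auto
      moreover have "adj k {frob 1 ?y} = k" by (rule adj_absorb[OF kf]) (use y(2) in simp)
      ultimately have "?y \<in> k" by (simp add: p_independent_def)
      then show ?case by (rule Suc.IH)
    qed
  qed
  then show ?case using 0 by blast
next
  case (Suc d)
  note k = Suc.prems(1) and dcc = Suc.prems(2) and kL = Suc.prems(3) and neq = Suc.prems(4) and rk = Suc.prems(5)
  note kf = pinsep_subfield[OF k] and kc = pinsep_carrier[OF k] and Lc = subfieldE(3)[OF L]
  show ?case
  proof (cases "adj k (frob 1 ` L) = L")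
    case False
    let ?m = "adj k (frob 1 ` L)"
    have m: "subfield ?m R" using Lc by (intro adj_subfield[OF kc]) blast
    have mL: "?m \<subseteq> L" by (rule adj_frob_subset[OF L kL])
    have "modular_extension R p L ?m" by (rule modular_exponent_one[OF L m mL adj_gens])
    then show ?thesis using m mL False adj_base[of k "frob 1 ` L"]
      by (intro exI[of _ ?m]) (simp add: intermediate_field_iff)
  next
    case True
    obtain T where tower: "T 0 = k \<and> (\<forall>j. subfield (T j) R \<and> T j \<subseteq> T (Suc j) \<and> T j \<subseteq> L \<and>
        adj k (frob 1 ` T (Suc j)) = T j \<and> T (Suc j) \<noteq> T j)"
      using exists_tower[OF k dcc L kL neq True] by (elim exE)
    have T0: "T 0 = k" and T: "subfield (T j) R" and inc: "T j \<subseteq> T (Suc j)" and TL: "T j \<subseteq> L"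
      and step: "adj k (frob 1 ` T (Suc j)) = T j" and strict: "T (Suc j) \<noteq> T j" for j
      using tower by simp_all
    let ?M = "\<Union>j. T j"
    show ?thesis
    proof (cases "?M = L")
      case True
      show ?thesis
        by (rule modular_over_proper_of_tower[OF k rk Lc T0 T inc step strict True])
    next
      case False
      have M: "subfield ?M R" by (rule subfield_chain_Union[of T, OF T inc])
      have kM: "k \<subseteq> ?M" using T0 by blast
      have subML: "?M \<subseteq> L" using TL by blast
      obtain m where m: "intermediate_field R L ?M m" "modular_extension R p L m" "m \<noteq> L"
        using Suc.IH[OF pinsep_mono[OF k M kM] dcc_mono[OF dcc kM] subML False[symmetric]
            rank_drop[OF k L rk T0 T inc step strict TL]] by blast
      then show ?thesis using kM by (intro exI[of _ m]) (auto simp: intermediate_field_iff)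
    qed
  qed
qed

section \<open>The characterisation\<close>

text \<open>
  Among the intermediate fields of unbounded rank choose a minimal one, \<open>L\<close>. By
  (ii) it is modular over a smaller field \<open>m\<close>. The rank of \<open>m\<close> over
  \<open>k\<close> is bounded by minimality, that of \<open>L\<close> over \<open>m\<close> by
  modularity.
\<close>

lemma exists_rank_bound:
  assumes k: "pinsep k" and dcc: "dcc k"
    and md: "\<And>L. intermediate_field R (carrier R) k L \<Longrightarrow> L \<noteq> k \<Longrightarrow> mod_field R p L k \<noteq> L"
  shows "\<exists>q. rank_le k (carrier R) q"
proof (rule ccontr)
  assume neg: "\<not> (\<exists>q. rank_le k (carrier R) q)"
  note kf = pinsep_subfield[OF k] and kc = pinsep_carrier[OF k]
  have "intermediate_field R (carrier R) k (carrier R)"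
    using carrier_is_subfield kc by (simp add: intermediate_field_iff)
  from dcc_minimal[OF dcc this, of "\<lambda>L. \<not> (\<exists>q. rank_le k L q)", OF neg]
  obtain L where L: "intermediate_field R (carrier R) k L" "\<not> (\<exists>q. rank_le k L q)"
    and min: "\<And>M. intermediate_field R (carrier R) k M \<Longrightarrow> \<not> (\<exists>q. rank_le k M q) \<Longrightarrow> M \<subseteq> L \<Longrightarrow> M = L"
    by blast
  have Lf: "subfield L R" and kL: "k \<subseteq> L" and Lc: "L \<subseteq> carrier R"
    using L(1) by (simp_all add: intermediate_field_iff)
  have "rank_le k k 0" unfolding rank_le_def
  proof (intro allI impI)
    fix xs assume xs: "set xs \<subseteq> k \<and> p_independent k xs"
    show "length xs \<le> 0"
    proof (cases xs)
      case (Cons x ys)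
      then show ?thesis using xs adj_base[of k "frob 1 ` set xs"] by (auto simp: p_independent_def)
    qed simp
  qed
  then have "L \<noteq> k" using L(2) by blast
  define m where "m = mod_field R p L k"
  have mneq: "m \<noteq> L" unfolding m_def by (rule md[OF L(1) \<open>L \<noteq> k\<close>])
  note mf = mod_field_least(1,2)[OF dcc Lf kL, folded m_def]
  have m: "subfield m R" "k \<subseteq> m" "m \<subseteq> L" using mf(1) by (simp_all add: intermediate_field_iff)
  have pm: "pinsep m" by (rule pinsep_mono[OF k m(1,2)])
  have "\<exists>q. rank_le k m q"
    using min[of m] m mneq Lc by (auto simp: intermediate_field_iff)
  then obtain q1 where q1: "rank_le k m q1" by blast
  have "rank_le m L (dim m {x \<in> L. frob 1 x \<in> m})"
    by (rule modular_rank_le[OF pm Lf m(3) mf(2) dcc_finite_level[OF dcc pm m(2) Lf m(3)]])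
  then have "\<exists>q. rank_le k L q" using rank_le_trans[OF k m(1) Lf m(2,3) q1] by blast
  then show False using L(2) by blast
qed

end

theorem mainTheorem12:
  fixes K :: "('a, 'b) ring_scheme" and p :: nat and k :: "'a set"
  assumes "field K"
    and "prime p" and "[p] \<cdot>\<^bsub>K\<^esub> \<one>\<^bsub>K\<^esub> = \<zero>\<^bsub>K\<^esub>"
    and "purely_inseparable K p (carrier K) k"
  shows "q_finite K p (carrier K) k \<longleftrightarrow>
    (\<forall>F :: nat \<Rightarrow> 'a set.
        (\<forall>n. intermediate_field K (carrier K) k (F n)) \<and> (\<forall>n. F (Suc n) \<subseteq> F n)
          \<longrightarrow> (\<exists>N. \<forall>n\<ge>N. F n = F N)) \<and>
    (\<forall>L. intermediate_field K (carrier K) k L \<and> L \<noteq> k \<longrightarrow> mod_field K p L k \<noteq> L)"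
proof -
  interpret char_p_field K p
    using assms(1-3) by (simp add: char_p_field_def char_p_field_axioms_def)
  have k: "pinsep k"
    using assms(4) by (simp add: pinsep_def purely_inseparable_def field_extension_def frob_def)
  have "q_finite K p (carrier K) k \<longleftrightarrow> dcc k \<and>
    (\<forall>L. intermediate_field K (carrier K) k L \<and> L \<noteq> k \<longrightarrow> mod_field K p L k \<noteq> L)"
    unfolding q_finite_iff_rank_le[OF k]
  proof (intro iffI conjI allI impI)
    assume "\<exists>q. rank_le k (carrier K) q"
    then obtain q where q: "rank_le k (carrier K) q" by blast
    show dcc: "dcc k" by (rule dcc_of_rank_le[OF k q])
    fix L assume "intermediate_field K (carrier K) k L \<and> L \<noteq> k"
    then have L: "subfield L K" "k \<subseteq> L" "L \<subseteq> carrier K" "L \<noteq> k"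
      by (simp_all add: intermediate_field_iff)
    have "rank_le k L q" by (rule rank_le_mono[OF q subset_refl L(3) pinsep_carrier[OF k] subset_refl])
    then obtain m where m: "intermediate_field K L k m" "modular_extension K p L m" "m \<noteq> L"
      using exists_proper_modular[OF L(1) k dcc L(2,4)] by blast
    have "mod_field K p L k \<subseteq> m" by (rule mod_field_least(3)[OF dcc L(1,2) m(1,2)])
    then show "mod_field K p L k \<noteq> L" using m by (auto simp: intermediate_field_iff)
  next
    assume "dcc k \<and> (\<forall>L. intermediate_field K (carrier K) k L \<and> L \<noteq> k \<longrightarrow> mod_field K p L k \<noteq> L)"
    then show "\<exists>q. rank_le k (carrier K) q" using exists_rank_bound[OF k] by blast
  qed
  then show ?thesis unfolding dcc_def .
qed

end
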